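(* Let $M,K\colon\mathbb{R}_+\to(0,\infty)$ be regularly growing functions with $K(s)\ge M(s)$ for all $s\ge0$, and let $M_K\colon\mathbb{R}_+\to(0,\infty)$ be defined by $M_K(s)=M(s)\big(\log(1+s)+\log(1+K(s))\big)$, $s\ge0$. Suppose that $M_K(s)=O(e^{\alpha s})$ as $s\to\infty$ for some $\alpha>0$. Then there exist a complex Banach space $X$ and a bounded $C_0$-semigroup $(T(t))_{t\ge0}$ on $X$ with generator $A$ such that, for some $\delta>1$, $\Omega_{\delta M}\subset\rho(A)$ and $$\sup_{\lambda\in\Omega_{\delta M}}\frac{\|R(\lambda,A)\|}{K(|\operatorname{Im}\lambda|)}<\infty,$$ and moreover $$\limsup_{t\to\infty}\big\|M_K^{-1}(t)\,T(t)A^{-1}\big\|>0.$$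
   Context: Here $\mathbb{R}_+=[0,\infty)$. A function $M\colon\mathbb{R}_+\to(0,\infty)$ is called regularly growing if it is non-decreasing and continuous and there exists $c\in(0,1)$ such that $$M(s)\ge c\,M\left(s+\frac{c}{M(s)}\right),\quad s\ge0.$$ For a continuous non-decreasing function $M\colon\mathbb{R}_+\to(0,\infty)$ define $$\Omega_M=\left\{\lambda\in\mathbb{C}:\operatorname{Re}\lambda>-\frac{1}{M(|\operatorname{Im}\lambda|)}\right\},$$ so that $\Omega_{\delta M}=\{\lambda\in\mathbb{C}:\operatorname{Re}\lambda>-1/(\delta M(|\operatorname{Im}\lambda|))\}$ for $\delta>1$. $\rho(A)$ denotes the resolvent set of $A$ and $R(\lambda,A)=(\lambda-A)^{-1}$ for $\lambda\in\rho(A)$; since $0\in\Omega_{\delta M}\subset\rho(A)$, $A^{-1}$ is a bounded operator. The function $M_K$ is continuous, strictly increasing and unbounded, and $M_K^{-1}$ denotes its inverse, defined on $[M_K(0),\infty)$ and hence for all sufficiently large $t$. *)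

theory Defs
  imports
    "HOL-Analysis.Analysis"
    "HOL-Library.Landau_Symbols"
    "HOL-Algebra.Module"
    "HOL-Decision_Procs.Algebra_Aux"
begin

subsection \<open>Complex Banach spaces with an explicit carrier\<close>

text \<open>
  HOL cannot quantify existentially over types, so a complex Banach space is a carrier set in some
  type together with its own operations and norm. It is a HOL-Algebra module over the field of
  complex numbers (\<^const>\<open>cring_class_ops\<close>); the multiplicative fields of the underlying
  ring record are not used, and all operations are unconstrained outside the carrier. To assert
  existence one fixes a sufficiently large type of vectors. The type \<open>real \<Rightarrow> complex\<close> suffices for
  every space with at most continuum many elements, in particular for every separable one and
  for every space of continuous functions on the half-line.
\<close>

record 'a complex_normed = "(complex, 'a) module" +
  nrm :: "'a \<Rightarrow> real"

definition norm_dist :: "('a, 'm) complex_normed_scheme \<Rightarrow> 'a \<Rightarrow> 'a \<Rightarrow> real" where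
  "norm_dist X x y =
     (if x \<in> carrier X \<and> y \<in> carrier X then nrm X (x \<ominus>\<^bsub>X\<^esub> y) else 0)"

locale complex_normed_space = Module.module "cring_class_ops :: complex ring" X
  for X :: "('a, 'm) complex_normed_scheme" (structure) +
  assumes nrm_nonneg: "x \<in> carrier X \<Longrightarrow> 0 \<le> nrm X x"
    and nrm_eq_0_iff: "x \<in> carrier X \<Longrightarrow> nrm X x = 0 \<longleftrightarrow> x = \<zero>\<^bsub>X\<^esub>"
    and nrm_smult: "x \<in> carrier X \<Longrightarrow> nrm X (a \<odot>\<^bsub>X\<^esub> x) = cmod a * nrm X x"
    and nrm_triangle: "x \<in> carrier X \<Longrightarrow> y \<in> carrier X \<Longrightarrow>
      nrm X (x \<oplus>\<^bsub>X\<^esub> y) \<le> nrm X x + nrm X y"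
begin

lemma nrm_minus_commute:
  assumes "x \<in> carrier X" "y \<in> carrier X"
  shows "nrm X (x \<ominus>\<^bsub>X\<^esub> y) = nrm X (y \<ominus>\<^bsub>X\<^esub> x)"
proof -
  have "(-1) \<odot>\<^bsub>X\<^esub> z = \<ominus>\<^bsub>X\<^esub> z" if z: "z \<in> carrier X" for z
    using smult_l_minus[of 1 z] smult_one[OF z] z
    by (simp add: carrier_class uminus_class one_class)
  then have "nrm X (\<ominus>\<^bsub>X\<^esub> z) = nrm X z" if "z \<in> carrier X" for z
    using nrm_smult[OF that, of "-1"] that by simp
  moreover have "x \<ominus>\<^bsub>X\<^esub> y = \<ominus>\<^bsub>X\<^esub> (y \<ominus>\<^bsub>X\<^esub> x)"
    using assms by (simp add: M.minus_eq M.minus_add M.add.m_comm)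
  ultimately show ?thesis using assms by simp
qed

sublocale norm_metric: Metric_space "carrier X" "norm_dist X"
proof
  fix x y z
  show "0 \<le> norm_dist X x y" by (simp add: norm_dist_def nrm_nonneg)
  show "norm_dist X x y = norm_dist X y x" by (simp add: norm_dist_def nrm_minus_commute)
  assume x: "x \<in> carrier X" and y: "y \<in> carrier X"
  show "norm_dist X x y = 0 \<longleftrightarrow> x = y"
  proof -
    have "(x \<ominus>\<^bsub>X\<^esub> y) \<oplus>\<^bsub>X\<^esub> y = x"
      using x y by (simp add: M.minus_eq M.add.m_assoc M.l_neg)
    then have "x \<ominus>\<^bsub>X\<^esub> y = \<zero>\<^bsub>X\<^esub> \<longleftrightarrow> x = y"
      using x y by (metis M.l_zero M.minus_eq M.r_neg)
    then show ?thesis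
      using x y by (simp add: norm_dist_def nrm_eq_0_iff)
  qed
  assume z: "z \<in> carrier X"
  have "x \<ominus>\<^bsub>X\<^esub> z = (x \<ominus>\<^bsub>X\<^esub> y) \<oplus>\<^bsub>X\<^esub> (y \<ominus>\<^bsub>X\<^esub> z)"
    using x y z by (simp add: M.minus_eq M.add.m_assoc M.r_neg1)
  then show "norm_dist X x z \<le> norm_dist X x y + norm_dist X y z"
    using x y z nrm_triangle by (simp add: norm_dist_def)
qed

end

definition complex_banach :: "('a, 'm) complex_normed_scheme \<Rightarrow> bool" where
  "complex_banach X \<longleftrightarrow>
     complex_normed_space X \<and> Metric_space.mcomplete (carrier X) (norm_dist X)"

subsection \<open>Operators\<close>

definition bounded_operator :: "('a, 'm) complex_normed_scheme \<Rightarrow> ('a \<Rightarrow> 'a) \<Rightarrow> bool" where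
  "bounded_operator X S \<longleftrightarrow>
     S \<in> carrier X \<rightarrow> carrier X \<and>
     (\<forall>x\<in>carrier X. \<forall>y\<in>carrier X. S (x \<oplus>\<^bsub>X\<^esub> y) = S x \<oplus>\<^bsub>X\<^esub> S y) \<and>
     (\<forall>a. \<forall>x\<in>carrier X. S (a \<odot>\<^bsub>X\<^esub> x) = a \<odot>\<^bsub>X\<^esub> S x) \<and>
     (\<exists>C. \<forall>x\<in>carrier X. nrm X (S x) \<le> C * nrm X x)"

definition op_norm :: "('a, 'm) complex_normed_scheme \<Rightarrow> ('a \<Rightarrow> 'a) \<Rightarrow> ereal" where
  "op_norm X S = (SUP x\<in>{x \<in> carrier X. nrm X x \<le> 1}. ereal (nrm X (S x)))"

text \<open>A possibly unbounded operator is given by its domain and a map, relevant on the domain only.\<close>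

type_synonym 'a unbounded_op = "'a set \<times> ('a \<Rightarrow> 'a)"

definition op_inverse :: "'a unbounded_op \<Rightarrow> 'a \<Rightarrow> 'a" where
  "op_inverse A = the_inv_into (fst A) (snd A)"

definition shifted_op ::
  "('a, 'm) complex_normed_scheme \<Rightarrow> complex \<Rightarrow> 'a unbounded_op \<Rightarrow> 'a unbounded_op" where
  "shifted_op X l A = (fst A, \<lambda>x. (l \<odot>\<^bsub>X\<^esub> x) \<ominus>\<^bsub>X\<^esub> snd A x)"

definition resolvent ::
  "('a, 'm) complex_normed_scheme \<Rightarrow> complex \<Rightarrow> 'a unbounded_op \<Rightarrow> 'a \<Rightarrow> 'a" where
  "resolvent X l A = op_inverse (shifted_op X l A)"

definition resolvent_set ::
  "('a, 'm) complex_normed_scheme \<Rightarrow> 'a unbounded_op \<Rightarrow> complex set" where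
  "resolvent_set X A =
     {l. bij_betw (snd (shifted_op X l A)) (fst A) (carrier X) \<and>
         bounded_operator X (resolvent X l A)}"

subsection \<open>Semigroups and generators\<close>

definition C0_semigroup ::
  "('a, 'm) complex_normed_scheme \<Rightarrow> (real \<Rightarrow> 'a \<Rightarrow> 'a) \<Rightarrow> bool" where
  "C0_semigroup X T \<longleftrightarrow>
     (\<forall>t\<ge>0. bounded_operator X (T t)) \<and>
     (\<forall>x\<in>carrier X. T 0 x = x) \<and>
     (\<forall>s\<ge>0. \<forall>t\<ge>0. \<forall>x\<in>carrier X. T (s + t) x = T s (T t x)) \<and>
     (\<forall>x\<in>carrier X. ((\<lambda>t. nrm X (T t x \<ominus>\<^bsub>X\<^esub> x)) \<longlongrightarrow> 0) (at_right 0))"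

definition bounded_semigroup ::
  "('a, 'm) complex_normed_scheme \<Rightarrow> (real \<Rightarrow> 'a \<Rightarrow> 'a) \<Rightarrow> bool" where
  "bounded_semigroup X T \<longleftrightarrow> (SUP t\<in>{0..}. op_norm X (T t)) < \<infinity>"

definition right_derivative_at_0 ::
  "('a, 'm) complex_normed_scheme \<Rightarrow> (real \<Rightarrow> 'a \<Rightarrow> 'a) \<Rightarrow> 'a \<Rightarrow> 'a \<Rightarrow> bool" where
  "right_derivative_at_0 X T x y \<longleftrightarrow> y \<in> carrier X \<and>
     ((\<lambda>h. nrm X ((complex_of_real (1 / h) \<odot>\<^bsub>X\<^esub> (T h x \<ominus>\<^bsub>X\<^esub> x)) \<ominus>\<^bsub>X\<^esub> y))
        \<longlongrightarrow> 0) (at_right 0)"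

definition generator ::
  "('a, 'm) complex_normed_scheme \<Rightarrow> (real \<Rightarrow> 'a \<Rightarrow> 'a) \<Rightarrow> 'a unbounded_op" where
  "generator X T =
     ({x \<in> carrier X. \<exists>y. right_derivative_at_0 X T x y},
      \<lambda>x. THE y. right_derivative_at_0 X T x y)"

subsection \<open>Growth functions\<close>

text \<open>Functions on the half-line are real functions of which only the values on [0,\<open>\<infinity>\<close>) matter.\<close>

definition regularly_growing :: "(real \<Rightarrow> real) \<Rightarrow> bool" where
  "regularly_growing M \<longleftrightarrow>
     (\<forall>s\<ge>0. 0 < M s) \<and> mono_on {0..} M \<and> continuous_on {0..} M \<and>
     (\<exists>c. 0 < c \<and> c < 1 \<and> (\<forall>s\<ge>0. M s \<ge> c * M (s + c / M s)))"

definition Omega :: "(real \<Rightarrow> real) \<Rightarrow> complex set" where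
  "Omega M = {l. Re l > - 1 / M \<bar>Im l\<bar>}"

definition MK :: "(real \<Rightarrow> real) \<Rightarrow> (real \<Rightarrow> real) \<Rightarrow> real \<Rightarrow> real" where
  "MK M K s = M s * (ln (1 + s) + ln (1 + K s))"

text \<open>The inverse of \<^term>\<open>MK M K\<close> on the half-line; unspecified for arguments below
  \<^term>\<open>MK M K 0\<close>.\<close>

definition MK_inv :: "(real \<Rightarrow> real) \<Rightarrow> (real \<Rightarrow> real) \<Rightarrow> real \<Rightarrow> real" where
  "MK_inv M K = the_inv_into {0..} (MK M K)"

end

theory Submission
  imports Defs "HOL-Computational_Algebra.Formal_Power_Series" "HOL-Real_Asymp.Real_Asymp"
begin

text \<open>
  The space is an \<open>\<ell>\<^sup>1\<close>-sum of finite-dimensional blocks. The \<open>n\<close>-th block carries the Jordan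
  block \<open>A\<^sub>n = (i s\<^sub>n - a\<^sub>n) + a\<^sub>n J\<close>, with \<open>J\<close> the nilpotent left shift, under the norm
  \<open>max\<^sub>k |f(k)| + w\<^sub>n (\<Sum>\<^sub>k q\<^sub>n\<^sup>k |f(k)|)\<close>. For both summands the semigroup \<open>exp (t A\<^sub>n)\<close> is contractive,
  because it averages \<open>f\<close> against a Poisson distribution. The weighted \<open>\<ell>\<^sup>1\<close>-part decays exponentially at
  rate about \<open>1/M(s\<^sub>n)\<close> and keeps the resolvent bounded by \<open>M(s\<^sub>n)\<close> there, and it controls the resolvent in
  the maximum norm up to the factor \<open>1/w\<^sub>n\<close>, of order \<open>K(s\<^sub>n)\<close>. Since \<open>A\<^sub>n\<close> is a bounded perturbation of
  \<open>i s\<^sub>n\<close> of size \<open>a\<^sub>n\<close>, its resolvent is small outside the disc of radius \<open>3 a\<^sub>n\<close> about \<open>i s\<^sub>n\<close>, so only the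
  behaviour of \<open>M\<close> and \<open>K\<close> near \<open>s\<^sub>n\<close> matters.

  The semigroup does not decay before time \<open>t = M\<^sub>K(s\<^sub>n)\<close>: the indicator of a window of width
  \<open>4 (a\<^sub>n t)\<^sup>1\<^sup>/\<^sup>2\<close> around \<open>a\<^sub>n t\<close> has bounded norm, and by Chebyshev's inequality it is mapped to a vector whose
  entry at \<open>0\<close> is at least \<open>3/4\<close>. As \<open>\<parallel>A\<^sub>n\<parallel>\<close> is of order \<open>s\<^sub>n\<close>, this gives \<open>\<parallel>T(t) A\<^sup>-\<^sup>1\<parallel> \<ge> c / s\<^sub>n\<close>.

  Suitable frequencies exist by a dichotomy. Either \<open>M(s) \<le> 2 M(s/2)\<close> with \<open>K(s) \<le> s\<^sup>1\<^sup>/\<^sup>4\<close> for arbitrarily large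
  \<open>s\<close>, and then \<open>a\<^sub>n\<close> can be taken proportional to \<open>s\<^sub>n\<close>; or \<open>K\<close> grows at least like a power of \<open>s\<close>, and then
  \<open>a\<^sub>n\<close> can be constant, because the exponential bound gives \<open>M\<^sub>K(s) \<le> C M\<^sub>K(s - 1)\<close> for arbitrarily large \<open>s\<close>.
\<close>

section \<open>Sums of seminormed blocks\<close>

text \<open>The bounds \<open>le_p\<close> and \<open>p_le\<close> make \<open>p n\<close>
  equivalent to the l1-norm of the coordinates in the finite set \<open>I n\<close>, so pointwise
  convergence implies convergence in \<open>p n\<close>. The constants \<open>B n\<close> may be
  unbounded in \<open>n\<close>; uniformity over the blocks comes from summability.\<close>

locale ell1_sum =
  fixes I :: "nat \<Rightarrow> 'x set" and p :: "nat \<Rightarrow> ('x \<Rightarrow> complex) \<Rightarrow> real" and B :: "nat \<Rightarrow> real"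
  assumes fin: "finite (I n)"
    and p_add: "p n (\<lambda>x. f x + g x) \<le> p n f + p n g"
    and p_smult: "p n (\<lambda>x. c * f x) = cmod c * p n f"
    and le_p: "x \<in> I n \<Longrightarrow> cmod (f x) \<le> p n f"
    and p_le: "p n f \<le> B n * (\<Sum>x\<in>I n. cmod (f x))"
begin

definition supported :: "('x \<Rightarrow> complex) \<Rightarrow> bool" where
  "supported f \<longleftrightarrow> (\<forall>x. x \<notin> (\<Union>n. I n) \<longrightarrow> f x = 0)"

definition E :: "('x \<Rightarrow> complex) set" where
  "E = {f. supported f \<and> summable (\<lambda>n. p n f)}"

definition N :: "('x \<Rightarrow> complex) \<Rightarrow> real" where
  "N f = (\<Sum>n. p n f)"

definition X :: "('x \<Rightarrow> complex) complex_normed" where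
  "X = \<lparr>carrier = E, mult = (\<lambda>f g. f), one = (\<lambda>_. 0), zero = (\<lambda>_. 0),
        add = (\<lambda>f g x. f x + g x), smult = (\<lambda>c f x. c * f x), nrm = N\<rparr>"

lemma X_simps [simp]:
  "carrier X = E" "zero X = (\<lambda>_. 0)" "add X f g = (\<lambda>x. f x + g x)"
  "smult X c f = (\<lambda>x. c * f x)" "nrm X f = N f"
  by (simp_all add: X_def)

lemma p_zero: "p n (\<lambda>_. 0) = 0"
  using p_smult[of n 0 "\<lambda>_. 0"] by simp

lemma p_uminus: "p n (\<lambda>x. - f x) = p n f"
  using p_smult[of n "-1" f] by simp

lemma p_diff_commute: "p n (\<lambda>x. f x - g x) = p n (\<lambda>x. g x - f x)"
  using p_uminus[of n "\<lambda>x. f x - g x"] by simp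

lemma p_nonneg: "0 \<le> p n f"
  using p_add[of n f "\<lambda>x. - f x"] by (simp add: p_zero p_uminus)

lemma p_diff: "p n (\<lambda>x. f x - g x) \<le> p n f + p n g"
  using p_add[of n f "\<lambda>x. - g x"] by (simp add: p_uminus)

lemma p_abs_diff: "\<bar>p n f - p n g\<bar> \<le> p n (\<lambda>x. f x - g x)"
  using p_add[of n "\<lambda>x. f x - g x" g] p_add[of n "\<lambda>x. g x - f x" f] p_diff_commute[of n f g]
  by (simp add: abs_le_iff)

lemma p_tendsto_0:
  assumes "\<And>x. x \<in> I n \<Longrightarrow> ((\<lambda>i. f i x) \<longlongrightarrow> 0) F"
  shows "((\<lambda>i. p n (f i)) \<longlongrightarrow> 0) F"
proof (rule Lim_null_comparison)
  have "((\<lambda>i. B n * (\<Sum>x\<in>I n. cmod (f i x))) \<longlongrightarrow> B n * (\<Sum>x\<in>I n. cmod 0)) F"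
    by (intro tendsto_intros assms)
  then show "((\<lambda>i. B n * (\<Sum>x\<in>I n. cmod (f i x))) \<longlongrightarrow> 0) F" by simp
  show "\<forall>\<^sub>F i in F. norm (p n (f i)) \<le> B n * (\<Sum>x\<in>I n. cmod (f i x))"
    by (simp add: p_nonneg p_le)
qed

lemma p_tendsto:
  assumes "\<And>x. x \<in> I n \<Longrightarrow> ((\<lambda>i. f i x) \<longlongrightarrow> g x) F"
  shows "((\<lambda>i. p n (f i)) \<longlongrightarrow> p n g) F"
proof -
  have "((\<lambda>i. p n (\<lambda>x. f i x - g x)) \<longlongrightarrow> 0) F"
    by (rule p_tendsto_0) (use assms in \<open>auto intro: Lim_null[THEN iffD1]\<close>)
  then have "((\<lambda>i. p n (f i) - p n g) \<longlongrightarrow> 0) F"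
    by (rule Lim_null_comparison[rotated]) (simp add: p_abs_diff)
  then show ?thesis by (rule Lim_null[THEN iffD2])
qed

lemma E_zero: "(\<lambda>_. 0) \<in> E"
  by (simp add: E_def supported_def p_zero)

lemma E_add: "f \<in> E \<Longrightarrow> g \<in> E \<Longrightarrow> (\<lambda>x. f x + g x) \<in> E"
  unfolding E_def supported_def
  by (auto intro: summable_comparison_test'[where N = 0 and g = "\<lambda>n. p n f + p n g"]
      simp: p_add p_nonneg summable_add)

lemma E_smult: "f \<in> E \<Longrightarrow> (\<lambda>x. c * f x) \<in> E"
  by (auto simp: E_def supported_def p_smult summable_mult)

lemma E_uminus: "f \<in> E \<Longrightarrow> (\<lambda>x. - f x) \<in> E"
  using E_smult[of f "-1"] by simp

lemma E_diff: "f \<in> E \<Longrightarrow> g \<in> E \<Longrightarrow> (\<lambda>x. f x - g x) \<in> E"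
  using E_add[OF _ E_uminus, of f g] by simp

lemma summable_p: "f \<in> E \<Longrightarrow> summable (\<lambda>n. p n f)"
  by (simp add: E_def)

lemma p_le_N: "f \<in> E \<Longrightarrow> p n f \<le> N f"
  unfolding N_def using sum_le_suminf[OF summable_p, of f "{n}"] by (simp add: p_nonneg)

lemma cmod_le_N:
  assumes f: "f \<in> E"
  shows "cmod (f x) \<le> N f"
proof (cases "x \<in> (\<Union>n. I n)")
  case True
  then obtain n where "x \<in> I n" by auto
  then show ?thesis using le_p[of x n f] p_le_N[OF f, of n] by linarith
next
  case False
  then have "f x = 0" using f by (auto simp: E_def supported_def)
  then show ?thesis using p_le_N[OF f, of 0] p_nonneg[of 0 f] by simp
qed

section \<open>The l1-sum of the blocks as a complex Banach space\<close>

lemma X_normed_space: "complex_normed_space X"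
proof (rule complex_normed_space.intro)
  show "Module.module (cring_class_ops :: complex ring) X"
  proof (rule moduleI)
    show "abelian_group X"
      by (rule abelian_groupI)
        (auto simp: E_add E_zero algebra_simps intro!: bexI[OF _ E_uminus])
  qed (auto simp: cring_class E_smult class_simps algebra_simps)
  show "complex_normed_space_axioms X"
  proof
    fix f g assume f: "f \<in> carrier X"
    then have f': "f \<in> E" by simp
    show "0 \<le> nrm X f"
      using f by (simp add: N_def suminf_nonneg summable_p p_nonneg)
    show "(nrm X f = 0) = (f = \<zero>\<^bsub>X\<^esub>)"
    proof
      assume "nrm X f = 0"
      then show "f = \<zero>\<^bsub>X\<^esub>" using cmod_le_N[OF f'] by (auto simp: fun_eq_iff)
    next
      assume "f = \<zero>\<^bsub>X\<^esub>"
      then show "nrm X f = 0" by (simp add: N_def p_zero)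
    qed
    show "nrm X (c \<odot>\<^bsub>X\<^esub> f) = cmod c * nrm X f" for c
      using f' by (simp add: N_def p_smult suminf_mult summable_p)
    assume "g \<in> carrier X"
    then have g': "g \<in> E" by simp
    show "nrm X (f \<oplus>\<^bsub>X\<^esub> g) \<le> nrm X f + nrm X g"
      using suminf_le[OF p_add summable_p[OF E_add[OF f' g']] summable_add[OF summable_p[OF f'] summable_p[OF g']]]
        suminf_add[OF summable_p[OF f'] summable_p[OF g']]
      by (simp add: N_def)
  qed
qed

sublocale XS: complex_normed_space X
  by (rule X_normed_space)

lemma X_uminus: "f \<in> E \<Longrightarrow> \<ominus>\<^bsub>X\<^esub> f = (\<lambda>x. - f x)"
  by (rule XS.M.minus_equality) (auto simp: E_uminus)

lemma X_minus: "f \<in> E \<Longrightarrow> g \<in> E \<Longrightarrow> f \<ominus>\<^bsub>X\<^esub> g = (\<lambda>x. f x - g x)"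
  by (simp add: a_minus_def X_uminus)

lemma N_le:
  assumes "supported f" "\<And>m. (\<Sum>n<m. p n f) \<le> c"
  shows "f \<in> E" "N f \<le> c"
proof -
  have "summable (\<lambda>n. p n f)"
    by (rule bounded_imp_summable[where B = c]) (use assms(2) in \<open>auto simp: p_nonneg lessThan_Suc_atMost[symmetric] simp del: sum.lessThan_Suc\<close>)
  then show "f \<in> E" "N f \<le> c"
    using assms by (auto simp: E_def N_def intro!: suminf_le_const)
qed

text \<open>A Cauchy sequence converges in every coordinate. The Cauchy bound passes to the limit in
  each finite partial sum of block norms, and \<open>N_le\<close> turns this into convergence in
  \<open>N\<close>.\<close>

lemma X_complete: "complex_banach X"
  unfolding complex_banach_def
proof
  show "complex_normed_space X" by (rule X_normed_space)
  show "Metric_space.mcomplete (carrier X) (norm_dist X)"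
    unfolding XS.norm_metric.mcomplete_def
  proof (intro allI impI)
    fix \<sigma> :: "nat \<Rightarrow> 'x \<Rightarrow> complex"
    assume "XS.norm_metric.MCauchy \<sigma>"
    then have "range \<sigma> \<subseteq> E"
      and cauchy: "\<And>e. e > 0 \<Longrightarrow> \<exists>m. \<forall>i j. m \<le> i \<longrightarrow> m \<le> j \<longrightarrow> norm_dist X (\<sigma> i) (\<sigma> j) < e"
      by (simp_all only: XS.norm_metric.MCauchy_def) simp_all
    then have \<sigma>: "\<And>i. \<sigma> i \<in> E" by auto
    have "norm_dist X (\<sigma> i) (\<sigma> j) = N (\<lambda>x. \<sigma> i x - \<sigma> j x)" for i j
      by (simp add: norm_dist_def X_minus \<sigma>)
    then have cau: "\<exists>m. \<forall>i\<ge>m. \<forall>j\<ge>m. N (\<lambda>x. \<sigma> i x - \<sigma> j x) < e" if "e > 0" for e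
      using cauchy[OF that] by simp
    have "Cauchy (\<lambda>i. \<sigma> i x)" for x
    proof (rule metric_CauchyI)
      fix e :: real assume "e > 0"
      from cau[OF this] obtain m where m: "\<forall>i\<ge>m. \<forall>j\<ge>m. N (\<lambda>x. \<sigma> i x - \<sigma> j x) < e" ..
      then have "\<forall>i\<ge>m. \<forall>j\<ge>m. dist (\<sigma> i x) (\<sigma> j x) < e"
        unfolding dist_norm using cmod_le_N[OF E_diff[OF \<sigma> \<sigma>]] le_less_trans by blast
      then show "\<exists>m. \<forall>i\<ge>m. \<forall>j\<ge>m. dist (\<sigma> i x) (\<sigma> j x) < e" by blast
    qed
    then have "\<exists>l. (\<lambda>i. \<sigma> i x) \<longlonglongrightarrow> l" for x
      by (auto simp: Cauchy_convergent_iff convergent_def)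
    then obtain g where g: "\<And>x. (\<lambda>i. \<sigma> i x) \<longlonglongrightarrow> g x" by metis
    have supp: "supported g"
      unfolding supported_def
    proof (intro allI impI)
      fix x assume "x \<notin> (\<Union>n. I n)"
      then have "\<sigma> i x = 0" for i using \<sigma>[of i] by (auto simp: E_def supported_def)
      then show "g x = 0" using g[of x] by (simp add: LIMSEQ_const_iff)
    qed
    have close: "\<exists>m. \<forall>i\<ge>m. (\<lambda>x. \<sigma> i x - g x) \<in> E \<and> N (\<lambda>x. \<sigma> i x - g x) \<le> e" if "e > 0" for e
    proof -
      from cau[OF that] obtain m where m: "\<And>i j. i \<ge> m \<Longrightarrow> j \<ge> m \<Longrightarrow> N (\<lambda>x. \<sigma> i x - \<sigma> j x) < e" by blast
      have "(\<Sum>n<k. p n (\<lambda>x. \<sigma> i x - g x)) \<le> e" if i: "i \<ge> m" for i k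
      proof (rule LIMSEQ_le_const2)
        show "(\<lambda>j. \<Sum>n<k. p n (\<lambda>x. \<sigma> i x - \<sigma> j x)) \<longlonglongrightarrow> (\<Sum>n<k. p n (\<lambda>x. \<sigma> i x - g x))"
          by (intro tendsto_intros p_tendsto g)
        show "\<exists>m. \<forall>j\<ge>m. (\<Sum>n<k. p n (\<lambda>x. \<sigma> i x - \<sigma> j x)) \<le> e"
        proof (intro exI[of _ m] allI impI)
          fix j assume "j \<ge> m"
          have "(\<Sum>n<k. p n (\<lambda>x. \<sigma> i x - \<sigma> j x)) \<le> N (\<lambda>x. \<sigma> i x - \<sigma> j x)"
            unfolding N_def by (rule sum_le_suminf) (auto simp: summable_p E_diff \<sigma> p_nonneg)
          then show "(\<Sum>n<k. p n (\<lambda>x. \<sigma> i x - \<sigma> j x)) \<le> e"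
            using m[OF i \<open>j \<ge> m\<close>] by linarith
        qed
      qed
      moreover have "supported (\<lambda>x. \<sigma> i x - g x)" for i
        using supp \<sigma>[of i] by (auto simp: E_def supported_def)
      ultimately show ?thesis using N_le by blast
    qed
    obtain m where "(\<lambda>x. \<sigma> m x - g x) \<in> E" using close[of 1] by auto
    from E_diff[OF \<sigma>[of m] this] have gE: "g \<in> E" by simp
    have "limitin XS.norm_metric.mtopology \<sigma> g sequentially"
      unfolding XS.norm_metric.limit_metric_sequentially
    proof (intro conjI allI impI)
      show "g \<in> carrier X" using gE by simp
      fix e :: real assume "e > 0"
      then obtain m where "\<forall>i\<ge>m. N (\<lambda>x. \<sigma> i x - g x) \<le> e / 2"
        using close[of "e / 2"] by auto
      then show "\<exists>m. \<forall>i\<ge>m. \<sigma> i \<in> carrier X \<and> norm_dist X (\<sigma> i) g < e"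
        using \<open>e > 0\<close> \<sigma> gE by (intro exI[of _ m]) (force simp: norm_dist_def X_minus)
    qed
    then show "\<exists>x. limitin XS.norm_metric.mtopology \<sigma> x sequentially" by blast
  qed
qed

section \<open>Operators acting block by block\<close>

lemma blockwise_bounded:
  assumes "\<And>f. supported f \<Longrightarrow> supported (S f)" "0 \<le> c" "f \<in> E"
    and "\<And>n. p n (S f) \<le> c * p n f"
  shows "S f \<in> E" "N (S f) \<le> c * N f"
proof -
  have s: "summable (\<lambda>n. c * p n f)" using assms(3) by (simp add: summable_p summable_mult)
  then have s': "summable (\<lambda>n. p n (S f))"
    by (rule summable_comparison_test'[where N = 0]) (simp add: assms(4) p_nonneg)
  then show "S f \<in> E" using assms(1,3) by (simp add: E_def)
  show "N (S f) \<le> c * N f"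
    unfolding N_def using suminf_le[OF assms(4) s' s] assms(3) by (simp add: suminf_mult summable_p)
qed

lemma bounded_operatorI:
  assumes "\<And>f. supported f \<Longrightarrow> supported (S f)" "0 \<le> c"
    and "\<And>f g. S (\<lambda>x. f x + g x) = (\<lambda>x. S f x + S g x)"
    and "\<And>a f. S (\<lambda>x. a * f x) = (\<lambda>x. a * S f x)"
    and "\<And>n f. p n (S f) \<le> c * p n f"
  shows "bounded_operator X S" "op_norm X S \<le> ereal c"
proof -
  have *: "S f \<in> E" "N (S f) \<le> c * N f" if "f \<in> E" for f
    using blockwise_bounded[of S c f] assms(1,2,5) that by auto
  show "bounded_operator X S"
    unfolding bounded_operator_def using * assms(3,4) by auto
  show "op_norm X S \<le> ereal c"
    unfolding op_norm_def
  proof (rule SUP_least)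
    fix f assume "f \<in> {x \<in> carrier X. nrm X x \<le> 1}"
    then have f: "f \<in> E" "N f \<le> 1" by auto
    then have "c * N f \<le> c" using assms(2) by (simp add: mult_left_le)
    then show "ereal (nrm X (S f)) \<le> ereal c" using *(2)[OF f(1)] by simp
  qed
qed

text \<open>Operators matter only on the carrier. The resolvent, being a
  \<open>the_inv_into\<close>, is compared with an explicit formula on \<open>E\<close>
  only.\<close>

lemma bounded_operator_cong:
  assumes "\<And>f. f \<in> E \<Longrightarrow> S f = S' f"
  shows "bounded_operator X S = bounded_operator X S'" "op_norm X S = op_norm X S'"
proof -
  show "bounded_operator X S = bounded_operator X S'"
    unfolding bounded_operator_def using assms E_add E_smult by (auto simp: Pi_iff)
  show "op_norm X S = op_norm X S'"
    unfolding op_norm_def using assms by (intro SUP_cong) auto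
qed

text \<open>Dominated convergence over the blocks: coordinatewise convergence gives convergence of
  each \<open>p n\<close>, and Tannery's theorem interchanges limit and sum.\<close>

lemma N_tendsto_0:
  assumes "\<And>n x. x \<in> I n \<Longrightarrow> ((\<lambda>h. f h x) \<longlongrightarrow> 0) F"
    and "eventually (\<lambda>h. \<forall>n. p n (f h) \<le> b n) F" and "summable b" "F \<noteq> bot"
  shows "((\<lambda>h. N (f h)) \<longlongrightarrow> 0) F"
proof -
  have "((\<lambda>h. \<Sum>n. p n (f h)) \<longlongrightarrow> (\<Sum>n. 0)) F"
  proof (rule tannerys_theorem[THEN conjunct2, THEN conjunct2])
    show "((\<lambda>h. p n (f h)) \<longlongrightarrow> 0) F" for n
      by (rule p_tendsto_0) (rule assms)
    show "eventually (\<lambda>(n, h). norm (p n (f h)) \<le> b n) (at_top \<times>\<^sub>F F)"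
      using assms(2) by (intro eventually_prod_filter[THEN iffD2] exI[of _ "\<lambda>_. True"] exI conjI) (auto simp: p_nonneg)
  qed (use assms in auto)
  then show ?thesis by (simp add: N_def)
qed

end

section \<open>Blockwise contraction semigroups, their generators and resolvents\<close>

text \<open>\<open>A\<close> is a formal generator, acting on every supported function even if the
  image leaves \<open>E\<close>, and \<open>T_deriv\<close> is only coordinatewise. Contractivity
  upgrades it to a derivative in norm.\<close>

locale ell1_semigroup = ell1_sum +
  fixes T :: "real \<Rightarrow> ('a \<Rightarrow> complex) \<Rightarrow> ('a \<Rightarrow> complex)"
    and A :: "('a \<Rightarrow> complex) \<Rightarrow> ('a \<Rightarrow> complex)"
  assumes T_add: "T t (\<lambda>x. f x + g x) = (\<lambda>x. T t f x + T t g x)"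
    and T_smult: "T t (\<lambda>x. c * f x) = (\<lambda>x. c * T t f x)"
    and T_supported: "supported f \<Longrightarrow> supported (T t f)"
    and T_contraction: "0 \<le> t \<Longrightarrow> p n (T t f) \<le> p n f"
    and T_0: "supported f \<Longrightarrow> T 0 f = f"
    and T_semigroup: "supported f \<Longrightarrow> T (s + t) f = T s (T t f)"
    and A_supported: "supported f \<Longrightarrow> supported (A f)"
    and T_deriv: "supported f \<Longrightarrow> ((\<lambda>h. (T h f x - f x) / h) \<longlongrightarrow> A f x) (at_right 0)"
begin

lemma T_bounded: 
  assumes "0 \<le> t" shows "bounded_operator X (T t)" "op_norm X (T t) \<le> 1"
  using bounded_operatorI[of "T t" 1] T_add T_smult T_supported T_contraction assms
  by (auto simp: one_ereal_def)

lemma T_in_E: "0 \<le> t \<Longrightarrow> f \<in> E \<Longrightarrow> T t f \<in> E"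
  using blockwise_bounded(1)[of "T t" 1 f] T_supported T_contraction by auto

lemma T_tendsto:
  assumes "supported f"
  shows "((\<lambda>h. T h f x - f x) \<longlongrightarrow> 0) (at_right 0)"
proof -
  have "((\<lambda>h. of_real h * ((T h f x - f x) / of_real h)) \<longlongrightarrow> of_real 0 * A f x) (at_right 0)"
    by (intro tendsto_mult T_deriv assms tendsto_of_real tendsto_ident_at)
  then have "((\<lambda>h. of_real h * ((T h f x - f x) / of_real h)) \<longlongrightarrow> 0) (at_right 0)"
    by simp
  then show ?thesis
    by (rule Lim_transform_eventually) (use eventually_at_right_less in eventually_elim, simp)
qed

lemma C0_semigroup_T: "C0_semigroup X T"
  unfolding C0_semigroup_def
proof (intro conjI allI impI ballI)
  fix f assume "f \<in> carrier X"
  then have f: "f \<in> E" by simp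
  then have sf: "supported f" by (simp add: E_def)
  show "T 0 f = f" by (simp add: T_0 sf)
  have *: "((\<lambda>h. N (\<lambda>x. T h f x - f x)) \<longlongrightarrow> 0) (at_right 0)"
  proof (rule N_tendsto_0[where b = "\<lambda>n. 2 * p n f"])
    show "\<forall>\<^sub>F h in at_right 0. \<forall>n. p n (\<lambda>x. T h f x - f x) \<le> 2 * p n f"
      using eventually_at_right_less
    proof eventually_elim
      case (elim h)
      show ?case using p_diff[of _ "T h f" f] T_contraction[of h _ f] elim
        by (smt (verit, ccfv_threshold))
    qed
  qed (use f sf T_tendsto in \<open>auto simp: summable_p summable_mult\<close>)
  show "((\<lambda>t. nrm X (T t f \<ominus>\<^bsub>X\<^esub> f)) \<longlongrightarrow> 0) (at_right 0)"
    by (rule Lim_transform_eventually[OF *], use eventually_at_right_less in eventually_elim)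
      (simp add: X_minus f T_in_E)
qed (auto simp: T_bounded T_semigroup E_def)

lemma bounded_semigroup_T: "bounded_semigroup X T"
proof -
  have "(SUP t\<in>{0..}. op_norm X (T t)) \<le> 1" by (rule SUP_least) (simp add: T_bounded)
  then show ?thesis unfolding bounded_semigroup_def by (rule le_less_trans) simp
qed

text \<open>Telescoping along a subdivision of \<open>[0, h]\<close> replaces the mean value inequality.\<close>

lemma T_difference_le:
  assumes "supported f" "0 \<le> h"
  shows "p n (\<lambda>x. T (real m * h) f x - f x) \<le> real m * p n (\<lambda>x. T h f x - f x)"
proof (induction m)
  case 0
  then show ?case by (simp add: T_0 assms p_zero)
next
  case (Suc m)
  have "T (real (Suc m) * h) f = T (real m * h) (T h f)"
    using T_semigroup[OF assms(1), of "real m * h" h] by (simp add: algebra_simps)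
  moreover have "T t (\<lambda>x. g x - f x) = (\<lambda>x. T t g x - T t f x)" for t g
    using T_add[of t g "\<lambda>x. - 1 * f x"] T_smult[of t "- 1" f] by simp
  moreover have "0 \<le> real m * h" using assms(2) by simp
  ultimately have "p n (\<lambda>x. T (real (Suc m) * h) f x - T (real m * h) f x) \<le> p n (\<lambda>x. T h f x - f x)"
    using T_contraction[of "real m * h" n "\<lambda>x. T h f x - f x"] assms(2) by presburger
  with Suc p_add[of n "\<lambda>x. T (real (Suc m) * h) f x - T (real m * h) f x" "\<lambda>x. T (real m * h) f x - f x"]
  show ?case by (simp add: algebra_simps)
qed

text \<open>Ever finer subdivisions of \<open>[0, h]\<close> bound the quotient over
  \<open>h\<close> by quotients over arbitrarily short steps, whose limit is \<open>A f\<close>.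
  This supplies the summable majorant for the derivative in \<open>N\<close>.\<close>

lemma T_quotient_le:
  assumes "supported f" "0 < h"
  shows "p n (\<lambda>x. (T h f x - f x) / h) \<le> p n (A f)"
proof (rule tendsto_lowerbound)
  define H where "H m = h / real (Suc m)" for m
  have H0: "H m > 0" for m using assms by (simp add: H_def)
  have "H \<longlonglongrightarrow> 0" unfolding H_def
    by (rule LIMSEQ_Suc[OF lim_const_over_n[of h]])
  then have Hlim: "filterlim H (at_right 0) sequentially"
    using H0 by (auto simp: filterlim_at less_imp_neq[THEN not_sym])
  show "(\<lambda>m. p n (\<lambda>x. (T (H m) f x - f x) / H m)) \<longlonglongrightarrow> p n (A f)"
    by (intro p_tendsto filterlim_compose[OF T_deriv Hlim] assms)
  have q: "p n (\<lambda>x. (T k f x - f x) / k) = p n (\<lambda>x. T k f x - f x) / k" if "k > 0" for k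
    using p_smult[of n "1 / of_real k" "\<lambda>x. T k f x - f x"] that by (simp add: norm_divide)
  have "p n (\<lambda>x. (T h f x - f x) / h) \<le> p n (\<lambda>x. (T (H m) f x - f x) / H m)" for m
  proof -
    have "real (Suc m) * H m = h" by (simp add: H_def)
    then have "p n (\<lambda>x. T h f x - f x) \<le> real (Suc m) * p n (\<lambda>x. T (H m) f x - f x)"
      using T_difference_le[of f "H m" n "Suc m"] H0[of m] assms by simp
    also have "\<dots> = h * (p n (\<lambda>x. T (H m) f x - f x) / H m)"
      using assms by (simp add: H_def)
    finally show ?thesis using assms q[OF assms(2)] q[OF H0[of m]] by (simp add: divide_le_eq mult.commute)
  qed
  then show "\<forall>\<^sub>F m in sequentially. p n (\<lambda>x. (T h f x - f x) / h) \<le> p n (\<lambda>x. (T (H m) f x - f x) / H m)"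
    by simp
qed simp

text \<open>Norm convergence forces coordinatewise convergence, which identifies the derivative as
  \<open>A f\<close>. Conversely, if \<open>A f \<in> E\<close>, then \<open>2 * p n (A f)\<close>
  is a summable majorant of the error. Hence the generator is \<open>A\<close> with maximal
  domain.\<close>

lemma right_derivative_iff:
  assumes f: "f \<in> E"
  shows "right_derivative_at_0 X T f g \<longleftrightarrow> g \<in> E \<and> g = A f"
proof -
  have sf: "supported f" using f by (simp add: E_def)
  have eq: "\<forall>\<^sub>F h in at_right 0. nrm X ((complex_of_real (1 / h) \<odot>\<^bsub>X\<^esub> (T h f \<ominus>\<^bsub>X\<^esub> f)) \<ominus>\<^bsub>X\<^esub> g)
      = N (\<lambda>x. (T h f x - f x) / h - g x) \<and> (\<lambda>x. (T h f x - f x) / h - g x) \<in> E" if g: "g \<in> E"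
    using eventually_at_right_less
  proof eventually_elim
    case (elim h)
    then have "(\<lambda>x. 1 / of_real h * (T h f x - f x)) \<in> E"
      by (intro E_smult E_diff T_in_E f) auto
    then show ?case using elim f g by (simp add: X_minus T_in_E E_diff)
  qed
  show ?thesis
  proof
    assume d: "right_derivative_at_0 X T f g"
    then have g: "g \<in> E" by (simp add: right_derivative_at_0_def)
    have lim: "((\<lambda>h. N (\<lambda>x. (T h f x - f x) / h - g x)) \<longlongrightarrow> 0) (at_right 0)"
      using d unfolding right_derivative_at_0_def
      by (auto elim!: Lim_transform_eventually intro: eventually_mono[OF eq[OF g]])
    have "g x = A f x" for x
    proof -
      have "((\<lambda>h. (T h f x - f x) / h - g x) \<longlongrightarrow> 0) (at_right 0)"
        by (rule Lim_null_comparison[OF _ lim]) 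
          (use eq[OF g] in eventually_elim, auto intro: cmod_le_N[where x = x and f = "\<lambda>x. (T _ f x - f x) / _ - g x"])
      then have "((\<lambda>h. (T h f x - f x) / h) \<longlongrightarrow> g x) (at_right 0)"
        by (rule Lim_null[THEN iffD2])
      from tendsto_unique[OF _ this T_deriv[OF sf]] show ?thesis by simp
    qed
    then show "g \<in> E \<and> g = A f" using g by auto
  next
    assume g: "g \<in> E \<and> g = A f"
    have "((\<lambda>h. N (\<lambda>x. (T h f x - f x) / h - g x)) \<longlongrightarrow> 0) (at_right 0)"
    proof (rule N_tendsto_0[where b = "\<lambda>n. 2 * p n g"])
      show "\<forall>\<^sub>F h in at_right 0. \<forall>n. p n (\<lambda>x. (T h f x - f x) / h - g x) \<le> 2 * p n g"
        using eventually_at_right_less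
      proof (eventually_elim, intro allI)
        fix h :: real and n assume "0 < h"
        then show "p n (\<lambda>x. (T h f x - f x) / h - g x) \<le> 2 * p n g"
          using p_diff[of n "\<lambda>x. (T h f x - f x) / h" g] T_quotient_le[OF sf, of h n] g by auto
      qed
      show "((\<lambda>h. (T h f x - f x) / h - g x) \<longlongrightarrow> 0) (at_right 0)" for x
        using T_deriv[OF sf, of x] g by (auto intro: Lim_null[THEN iffD1])
    qed (use g in \<open>auto simp: summable_p summable_mult\<close>)
    then show "right_derivative_at_0 X T f g"
      unfolding right_derivative_at_0_def using g
      by (auto elim!: Lim_transform_eventually intro: eventually_mono[OF eq])
  qed
qed

lemma generator_domain: "fst (generator X T) = {f \<in> E. A f \<in> E}"
  by (auto simp: generator_def right_derivative_iff)

lemma generator_apply: "f \<in> E \<Longrightarrow> A f \<in> E \<Longrightarrow> snd (generator X T) f = A f"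
  by (auto simp: generator_def right_derivative_iff)

text \<open>\<open>R\<close> maps into the domain because \<open>A (R f) = l R f - f\<close> is
  again in \<open>E\<close>. The two formal inverse identities then give a bijection, and the block
  bound uniform in \<open>n\<close> gives boundedness.\<close>

lemma resolventI:
  assumes R_supported: "\<And>f. supported f \<Longrightarrow> supported (R f)" and "0 \<le> c"
    and R_add: "\<And>f g. R (\<lambda>x. f x + g x) = (\<lambda>x. R f x + R g x)"
    and R_smult: "\<And>a f. R (\<lambda>x. a * f x) = (\<lambda>x. a * R f x)"
    and R_le: "\<And>n f. p n (R f) \<le> c * p n f"
    and R_left: "\<And>f. supported f \<Longrightarrow> R (\<lambda>x. l * f x - A f x) = f"
    and R_right: "\<And>f. supported f \<Longrightarrow> (\<lambda>x. l * R f x - A (R f) x) = f"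
  shows "l \<in> resolvent_set X (generator X T)"
    and "op_norm X (resolvent X l (generator X T)) \<le> ereal c"
proof -
  let ?D = "{f \<in> E. A f \<in> E}" and ?S = "snd (shifted_op X l (generator X T))"
  have R_E: "R f \<in> E" if "f \<in> E" for f
    using blockwise_bounded(1)[of R c f] R_supported \<open>0 \<le> c\<close> that R_le by auto
  have S: "?S f = (\<lambda>x. l * f x - A f x)" if "f \<in> ?D" for f
    using that by (simp add: shifted_op_def generator_apply X_minus E_smult)
  have RD: "R f \<in> ?D" and SR: "?S (R f) = f" if f: "f \<in> E" for f
  proof -
    have sf: "supported f" using f by (simp add: E_def)
    have "A (R f) = (\<lambda>x. l * R f x - f x)"
      using R_right[OF sf] by (auto simp: fun_eq_iff algebra_simps)
    then show D: "R f \<in> ?D" using R_E[OF f] f by (simp add: E_diff E_smult)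
    show "?S (R f) = f" using S[OF D] R_right[OF sf] by simp
  qed
  have RS: "R (?S f) = f" if "f \<in> ?D" for f
    using S[OF that] R_left[of f] that by (simp add: E_def)
  have SE: "?S f \<in> E" if "f \<in> ?D" for f
    using that S[OF that] by (simp add: E_diff E_smult)
  have fst: "fst (shifted_op X l (generator X T)) = ?D"
    by (simp add: shifted_op_def generator_domain)
  have bij: "bij_betw ?S ?D E"
    by (rule bij_betw_byWitness[where f' = R]) (use RD SR RS SE in auto)
  have res: "resolvent X l (generator X T) f = R f" if "f \<in> E" for f
    unfolding resolvent_def op_inverse_def fst
    by (rule the_inv_into_f_eq) (use bij RD SR that in \<open>auto simp: bij_betw_def\<close>)
  have R: "bounded_operator X R" "op_norm X R \<le> ereal c"
    using bounded_operatorI[of R c] R_supported \<open>0 \<le> c\<close> R_add R_smult R_le by auto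
  show "l \<in> resolvent_set X (generator X T)"
    unfolding resolvent_set_def 
    using bij R(1) bounded_operator_cong(1)[OF res]
    by (auto simp: shifted_op_def generator_domain)
  show "op_norm X (resolvent X l (generator X T)) \<le> ereal c"
    using R(2) bounded_operator_cong(2)[OF res] by simp
qed

lemma op_inverse_generator:
  assumes "0 \<in> resolvent_set X (generator X T)" "f \<in> E" "A f \<in> E"
  shows "op_inverse (generator X T) (A f) = f"
proof -
  \<comment> \<open>At \<open>0\<close> the shifted operator is the negative of the generator, so
    injectivity transfers.\<close>
  have "inj_on (snd (shifted_op X 0 (generator X T))) {f \<in> E. A f \<in> E}"
    using assms(1) by (auto simp: resolvent_set_def bij_betw_def shifted_op_def generator_domain)
  moreover have "snd (shifted_op X 0 (generator X T)) g = (\<lambda>x. - A g x)" if "g \<in> {f \<in> E. A f \<in> E}" for g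
    using that by (simp add: shifted_op_def generator_apply X_minus E_zero)
  ultimately have "inj_on (snd (generator X T)) {f \<in> E. A f \<in> E}"
    by (auto simp: inj_on_def generator_apply)
  then show ?thesis
    unfolding op_inverse_def generator_domain
    using assms by (intro the_inv_into_f_eq) (auto simp: generator_apply)
qed

end

section \<open>Blocks of Toeplitz operators\<close>

text \<open>Embedding the index pairs into the reals places all blocks on disjoint sets of points
  and gives the vectors the type \<open>real \<Rightarrow> complex\<close>.\<close>

definition coord :: "nat \<Rightarrow> nat \<Rightarrow> real" where
  "coord n k = real (prod_encode (n, k))"

lemma coord_eq_iff [simp]: "coord n k = coord m j \<longleftrightarrow> n = m \<and> k = j"
  by (simp add: coord_def prod_encode_eq)

locale toeplitz_blocks =
  fixes d :: "nat \<Rightarrow> nat" and q w :: "nat \<Rightarrow> real"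
  assumes d_pos: "0 < d n" and q_ge_1: "1 \<le> q n" and w_pos: "0 < w n"
begin

definition blocks :: "nat \<Rightarrow> real set" where
  "blocks n = coord n ` {..<d n}"

definition block_max :: "nat \<Rightarrow> (real \<Rightarrow> complex) \<Rightarrow> real" where
  "block_max n f = Max ((\<lambda>k. cmod (f (coord n k))) ` {..<d n})"

definition block_sum :: "nat \<Rightarrow> (real \<Rightarrow> complex) \<Rightarrow> real" where
  "block_sum n f = (\<Sum>k<d n. q n ^ k * cmod (f (coord n k)))"

definition block_norm :: "nat \<Rightarrow> (real \<Rightarrow> complex) \<Rightarrow> real" where
  "block_norm n f = block_max n f + w n * block_sum n f"

text \<open>On block \<open>n\<close> this is the power series \<open>c n\<close> evaluated at the
  nilpotent left shift J. Decoding the integer part of \<open>x\<close> recovers its index pair, and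
  the test \<open>x = coord n k\<close> discards all other reals.\<close>

definition toep :: "(nat \<Rightarrow> complex fps) \<Rightarrow> (real \<Rightarrow> complex) \<Rightarrow> real \<Rightarrow> complex" where
  "toep c f x = (case prod_decode (nat \<lfloor>x\<rfloor>) of (n, k) \<Rightarrow>
     if x = coord n k \<and> k < d n then \<Sum>j<d n - k. fps_nth (c n) j * f (coord n (k + j)) else 0)"

lemma toep_coord:
  "toep c f (coord n k) = (if k < d n then \<Sum>j<d n - k. fps_nth (c n) j * f (coord n (k + j)) else 0)"
  by (simp add: toep_def coord_def)

lemma toep_outside: "(\<And>n k. k < d n \<Longrightarrow> x \<noteq> coord n k) \<Longrightarrow> toep c f x = 0"
  by (auto simp: toep_def split: prod.split)

lemma eq_on_coordI:
  assumes "\<And>n k. k < d n \<Longrightarrow> f (coord n k) = g (coord n k)"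
    and "\<And>x. (\<And>n k. k < d n \<Longrightarrow> x \<noteq> coord n k) \<Longrightarrow> f x = g x"
  shows "f = g"
proof
  fix x show "f x = g x" using assms by (cases "\<exists>n k. k < d n \<and> x = coord n k") auto
qed

lemma toep_add: "toep c (\<lambda>x. f x + g x) = (\<lambda>x. toep c f x + toep c g x)"
  by (auto simp: toep_def sum.distrib algebra_simps split: prod.split)

lemma toep_smult: "toep c (\<lambda>x. a * f x) = (\<lambda>x. a * toep c f x)"
  by (auto simp: toep_def sum_distrib_left algebra_simps split: prod.split)

lemma toep_fps_diff: "toep (\<lambda>n. c n - e n) f = (\<lambda>x. toep c f x - toep e f x)"
  by (auto simp: toep_def sum_subtractf algebra_simps split: prod.split)

lemma toep_fps_const: "toep (\<lambda>n. fps_const a * e n) f = (\<lambda>x. a * toep e f x)"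
  by (auto simp: toep_def sum_distrib_left algebra_simps split: prod.split)

text \<open>Evaluation at the shift is multiplicative: the double sum over the triangle
  \<open>i + j < d n - k\<close> regroups into the Cauchy product.\<close>

lemma toep_toep: "toep c (toep e f) = toep (\<lambda>n. c n * e n) f"
proof (rule eq_on_coordI)
  fix n k assume k: "k < d n"
  let ?L = "d n - k"
  let ?g = "\<lambda>i j. fps_nth (c n) i * (fps_nth (e n) j * f (coord n (k + (i + j))))"
  have "toep c (toep e f) (coord n k) = (\<Sum>i<?L. \<Sum>j<?L - i. ?g i j)"
    using k by (auto simp: toep_coord sum_distrib_left add.assoc intro!: sum.cong)
  also have "\<dots> = (\<Sum>(i, j)\<in>(SIGMA i:{..<?L}. {..<?L - i}). ?g i j)"
    by (rule sum.Sigma) auto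
  also have "(SIGMA i:{..<?L}. {..<?L - i}) = {(i, j). i + j < ?L}" by auto
  also have "(\<Sum>(i, j)\<in>{(i, j). i + j < ?L}. ?g i j) = (\<Sum>m<?L. \<Sum>i\<le>m. ?g i (m - i))"
    by (rule sum.triangle_reindex)
  also have "\<dots> = toep (\<lambda>n. c n * e n) f (coord n k)"
    using k by (auto simp: toep_coord fps_mult_nth sum_distrib_right atLeast0AtMost mult.assoc intro!: sum.cong)
  finally show "toep c (toep e f) (coord n k) = toep (\<lambda>n. c n * e n) f (coord n k)" .
qed (simp add: toep_outside)

lemma block_max_ge: "k < d n \<Longrightarrow> cmod (f (coord n k)) \<le> block_max n f"
  unfolding block_max_def by (rule Max_ge) auto

lemma block_max_le: "(\<And>k. k < d n \<Longrightarrow> cmod (f (coord n k)) \<le> b) \<Longrightarrow> block_max n f \<le> b"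
  unfolding block_max_def using d_pos[of n] by (subst Max_le_iff) auto

lemma block_max_nonneg: "0 \<le> block_max n f"
  using block_max_ge[OF d_pos[of n], of f] norm_ge_zero[of "f (coord n 0)"] by linarith

lemma q_pos: "0 < q n"
  using q_ge_1[of n] by linarith

lemma block_sum_nonneg: "0 \<le> block_sum n f"
  unfolding block_sum_def using q_pos[of n] by (intro sum_nonneg) simp

lemma block_norm_le:
  assumes "block_max n f \<le> x" "block_sum n f \<le> y"
  shows "block_norm n f \<le> x + w n * y"
  using assms w_pos[of n] by (simp add: block_norm_def add_mono)

sublocale ell1_sum blocks block_norm "\<lambda>n. 1 + w n * q n ^ d n"
proof
  fix n and f g :: "real \<Rightarrow> complex"
  show "finite (blocks n)" by (simp add: blocks_def)
  have "block_max n (\<lambda>x. f x + g x) \<le> block_max n f + block_max n g"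
    by (rule block_max_le) (use block_max_ge norm_triangle_ineq add_mono order_trans in metis)
  moreover have "block_sum n (\<lambda>x. f x + g x) \<le> block_sum n f + block_sum n g"
    unfolding block_sum_def sum.distrib[symmetric] distrib_left[symmetric]
    using q_pos[of n] by (intro sum_mono mult_left_mono norm_triangle_ineq) simp
  ultimately show "block_norm n (\<lambda>x. f x + g x) \<le> block_norm n f + block_norm n g"
    using block_norm_le by (fastforce simp: block_norm_def algebra_simps)
  show "block_norm n (\<lambda>x. c * f x) = cmod c * block_norm n f" for c
  proof -
    have "(\<lambda>k. cmod (c * f (coord n k))) ` {..<d n} = (*) (cmod c) ` (\<lambda>k. cmod (f (coord n k))) ` {..<d n}"
      by (simp add: norm_mult image_image)
    moreover have "Max ((*) (cmod c) ` (\<lambda>k. cmod (f (coord n k))) ` {..<d n})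
        = cmod c * Max ((\<lambda>k. cmod (f (coord n k))) ` {..<d n})"
      using d_pos[of n] by (intro mono_Max_commute[symmetric]) (auto simp: mono_def mult_left_mono)
    ultimately show ?thesis
      by (simp add: block_norm_def block_max_def block_sum_def norm_mult sum_distrib_left algebra_simps)
  qed
  show "cmod (f x) \<le> block_norm n f" if x: "x \<in> blocks n" for x
  proof -
    have "cmod (f x) \<le> block_max n f" using x block_max_ge by (auto simp: blocks_def)
    moreover have "0 \<le> w n * block_sum n f" using w_pos[of n] block_sum_nonneg[of n f] by simp
    ultimately show ?thesis by (simp add: block_norm_def)
  qed
  have S: "(\<Sum>x\<in>blocks n. cmod (f x)) = (\<Sum>k<d n. cmod (f (coord n k)))"
    by (simp add: blocks_def sum.reindex inj_on_def)
  have "block_max n f \<le> (\<Sum>x\<in>blocks n. cmod (f x))"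
    unfolding S by (intro block_max_le member_le_sum) auto
  moreover have "block_sum n f \<le> q n ^ d n * (\<Sum>x\<in>blocks n. cmod (f x))"
    unfolding S block_sum_def sum_distrib_left
    using q_ge_1[of n] by (intro sum_mono mult_right_mono power_increasing) auto
  ultimately show "block_norm n f \<le> (1 + w n * q n ^ d n) * (\<Sum>x\<in>blocks n. cmod (f x))"
    by (rule block_norm_le[THEN order_trans]) (simp add: algebra_simps)
qed

lemma supported_iff: "supported f \<longleftrightarrow> (\<forall>x. (\<forall>n k. k < d n \<longrightarrow> x \<noteq> coord n k) \<longrightarrow> f x = 0)"
  by (auto simp: supported_def blocks_def)

lemma toep_supported: "supported (toep c f)"
  by (auto simp: supported_iff intro: toep_outside)

lemma toep_one:
  assumes "supported f"
  shows "toep (\<lambda>n. 1) f = f"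
proof (rule eq_on_coordI)
  fix n k assume k: "k < d n"
  then obtain m where "d n - k = Suc m" by (metis Suc_diff_Suc)
  then show "toep (\<lambda>n. 1) f (coord n k) = f (coord n k)"
    using k by (simp add: toep_coord sum.lessThan_Suc_shift del: sum.lessThan_Suc)
qed (use assms in \<open>auto simp: toep_outside supported_iff\<close>)

section \<open>Norm estimates for Toeplitz operators\<close>

lemma block_max_toep:
  assumes "(\<Sum>j<d n. cmod (fps_nth (c n) j)) \<le> b"
  shows "block_max n (toep c f) \<le> b * block_max n f"
proof (rule block_max_le)
  fix k assume k: "k < d n"
  have "cmod (toep c f (coord n k)) \<le> (\<Sum>j<d n - k. cmod (fps_nth (c n) j) * cmod (f (coord n (k + j))))"
    using k by (simp add: toep_coord norm_mult[symmetric] norm_sum del: norm_mult)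
  also have "\<dots> \<le> (\<Sum>j<d n - k. cmod (fps_nth (c n) j) * block_max n f)"
    by (intro sum_mono mult_left_mono block_max_ge) auto
  also have "\<dots> \<le> (\<Sum>j<d n. cmod (fps_nth (c n) j) * block_max n f)"
    by (intro sum_mono2) (auto simp: block_max_nonneg)
  also have "\<dots> \<le> b * block_max n f"
    unfolding sum_distrib_right[symmetric] by (intro mult_right_mono assms block_max_nonneg)
  finally show "cmod (toep c f (coord n k)) \<le> b * block_max n f" .
qed

text \<open>The entry at \<open>k + j\<close> carries a weight of at least \<open>q n ^ j\<close> in
  the weighted sum, which offsets coefficients growing like \<open>q n ^ j\<close>.\<close>

lemma block_max_toep_sum:
  assumes "\<And>j. j < d n \<Longrightarrow> cmod (fps_nth (c n) j) \<le> b * q n ^ j" "0 \<le> b"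
  shows "block_max n (toep c f) \<le> b * block_sum n f"
proof (rule block_max_le)
  fix k assume k: "k < d n"
  have "cmod (toep c f (coord n k)) \<le> (\<Sum>j<d n - k. cmod (fps_nth (c n) j) * cmod (f (coord n (k + j))))"
    using k by (simp add: toep_coord norm_mult[symmetric] norm_sum del: norm_mult)
  also have "\<dots> \<le> (\<Sum>j<d n - k. b * (q n ^ (k + j) * cmod (f (coord n (k + j)))))"
  proof (intro sum_mono)
    fix j assume j: "j \<in> {..<d n - k}"
    have "cmod (fps_nth (c n) j) \<le> b * q n ^ j" using j by (intro assms) auto
    also have "\<dots> \<le> b * q n ^ (k + j)"
      using q_ge_1[of n] assms(2) by (intro mult_left_mono power_increasing) auto
    finally show "cmod (fps_nth (c n) j) * cmod (f (coord n (k + j))) \<le> b * (q n ^ (k + j) * cmod (f (coord n (k + j))))"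
      by (simp add: mult.assoc[symmetric] mult_right_mono)
  qed
  also have "\<dots> = b * (\<Sum>i\<in>{k..<d n}. q n ^ i * cmod (f (coord n i)))"
    unfolding sum_distrib_left[symmetric]
    by (intro arg_cong[where f = "(*) b"] sum.reindex_bij_witness[of _ "\<lambda>i. i - k" "\<lambda>j. k + j"]) auto
  also have "\<dots> \<le> b * block_sum n f"
    unfolding block_sum_def using q_pos[of n] assms(2) by (intro mult_left_mono sum_mono2) auto
  finally show "cmod (toep c f (coord n k)) \<le> b * block_sum n f" .
qed

text \<open>Moving an entry from \<open>k + j\<close> to \<open>k\<close> divides its weight by
  \<open>q n ^ j\<close>, so the shift has norm at most \<open>1 / q n\<close> in the weighted
  l1-norm.\<close>

lemma block_sum_toep:
  assumes "(\<Sum>j<d n. cmod (fps_nth (c n) j) / q n ^ j) \<le> b"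
  shows "block_sum n (toep c f) \<le> b * block_sum n f"
proof -
  let ?g = "\<lambda>i. q n ^ i * cmod (f (coord n i))"
  have "block_sum n (toep c f) \<le> (\<Sum>k<d n. q n ^ k * (\<Sum>j<d n - k. cmod (fps_nth (c n) j) * cmod (f (coord n (k + j)))))"
    unfolding block_sum_def using q_pos[of n]
    by (intro sum_mono mult_left_mono) (auto simp: toep_coord norm_mult[symmetric] norm_sum simp del: norm_mult)
  also have "\<dots> = (\<Sum>k<d n. \<Sum>j<d n - k. cmod (fps_nth (c n) j) / q n ^ j * ?g (k + j))"
    using q_pos[of n] by (auto simp: sum_distrib_left power_add field_simps intro!: sum.cong)
  also have "\<dots> = (\<Sum>(k, j)\<in>(SIGMA k:{..<d n}. {..<d n - k}). cmod (fps_nth (c n) j) / q n ^ j * ?g (k + j))"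
    by (rule sum.Sigma) auto
  also have "\<dots> = (\<Sum>(j, k)\<in>(SIGMA j:{..<d n}. {..<d n - j}). cmod (fps_nth (c n) j) / q n ^ j * ?g (k + j))"
    by (rule sum.reindex_bij_witness[of _ prod.swap prod.swap]) auto
  also have "\<dots> = (\<Sum>j<d n. \<Sum>k<d n - j. cmod (fps_nth (c n) j) / q n ^ j * ?g (k + j))"
    by (rule sum.Sigma[symmetric]) auto
  also have "\<dots> \<le> (\<Sum>j<d n. cmod (fps_nth (c n) j) / q n ^ j * block_sum n f)"
    unfolding sum_distrib_left[symmetric]
  proof (intro sum_mono mult_left_mono)
    fix j
    have "(\<Sum>k<d n - j. ?g (k + j)) = (\<Sum>i\<in>{j..<d n}. ?g i)"
      by (rule sum.reindex_bij_witness[of _ "\<lambda>i. i - j" "\<lambda>k. k + j"]) auto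
    also have "\<dots> \<le> block_sum n f"
      unfolding block_sum_def using q_pos[of n] by (intro sum_mono2) auto
    finally show "(\<Sum>k<d n - j. ?g (k + j)) \<le> block_sum n f" .
  qed (use q_pos[of n] in auto)
  also have "\<dots> \<le> b * block_sum n f"
    unfolding sum_distrib_right[symmetric] by (intro mult_right_mono assms block_sum_nonneg)
  finally show ?thesis .
qed

lemma block_norm_toep:
  assumes "(\<Sum>j<d n. cmod (fps_nth (c n) j)) \<le> b"
  shows "block_norm n (toep c f) \<le> b * block_norm n f"
proof -
  have "(\<Sum>j<d n. cmod (fps_nth (c n) j) / q n ^ j) \<le> (\<Sum>j<d n. cmod (fps_nth (c n) j))"
  proof (rule sum_mono)
    fix j show "cmod (fps_nth (c n) j) / q n ^ j \<le> cmod (fps_nth (c n) j)"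
      using divide_left_mono[of 1 "q n ^ j" "cmod (fps_nth (c n) j)"] q_ge_1[of n] q_pos[of n]
      by (simp add: one_le_power)
  qed
  then have "block_sum n (toep c f) \<le> b * block_sum n f"
    using assms by (intro block_sum_toep) linarith
  with block_max_toep[of c n b f, OF assms] show ?thesis
    by (rule block_norm_le[THEN order_trans]) (simp add: block_norm_def algebra_simps)
qed

text \<open>The maximum part is estimated by the weighted sum instead of by itself, at the price of
  \<open>1 / w n\<close>. This admits geometrically growing coefficients.\<close>

lemma block_norm_toep_weighted:
  assumes "\<And>j. j < d n \<Longrightarrow> cmod (fps_nth (c n) j) \<le> b * q n ^ j" "0 \<le> b"
    and "(\<Sum>j<d n. cmod (fps_nth (c n) j) / q n ^ j) \<le> e"
  shows "block_norm n (toep c f) \<le> (b / w n + e) * block_norm n f"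
proof -
  have "0 \<le> (\<Sum>j<d n. cmod (fps_nth (c n) j) / q n ^ j)"
    using q_pos[of n] by (intro sum_nonneg) simp
  then have "0 \<le> e" using assms(3) by linarith
  have "block_max n (toep c f) \<le> b * block_sum n f"
    by (rule block_max_toep_sum) (use assms in auto)
  moreover have "block_sum n (toep c f) \<le> e * block_sum n f"
    by (intro block_sum_toep assms)
  ultimately have "block_norm n (toep c f) \<le> b * block_sum n f + w n * (e * block_sum n f)"
    by (rule block_norm_le)
  also have "\<dots> = (b / w n + e) * (w n * block_sum n f)"
    using w_pos[of n] by (simp add: algebra_simps)
  also have "\<dots> \<le> (b / w n + e) * block_norm n f"
    using w_pos[of n] assms(2) \<open>0 \<le> e\<close> block_max_nonneg[of n f]
    by (intro mult_left_mono) (auto simp: block_norm_def)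
  finally show ?thesis .
qed

end

section \<open>Jordan blocks, their semigroup and resolvent\<close>

text \<open>With \<open>Re (z n) = - a n\<close>, the coefficients of
  \<open>exp (t (z n + a n J))\<close> are in modulus a Poisson distribution with mean
  \<open>a n * t\<close>; its total mass one yields contractivity.\<close>

locale jordan_blocks = toeplitz_blocks +
  fixes z :: "nat \<Rightarrow> complex" and a :: "nat \<Rightarrow> real"
  assumes a_pos: "0 < a n" and Re_z: "Re (z n) = - a n"
begin

definition T :: "real \<Rightarrow> (real \<Rightarrow> complex) \<Rightarrow> real \<Rightarrow> complex" where
  "T t = toep (\<lambda>n. fps_const (exp (t * z n)) * fps_exp (t * a n))"

definition A :: "(real \<Rightarrow> complex) \<Rightarrow> real \<Rightarrow> complex" where
  "A = toep (\<lambda>n. fps_const (z n) + fps_const (of_real (a n)) * fps_X)"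

text \<open>The Neumann series of \<open>1 / (l - z n - a n J)\<close> in powers of the
  shift.\<close>

definition R :: "complex \<Rightarrow> (real \<Rightarrow> complex) \<Rightarrow> real \<Rightarrow> complex" where
  "R l = toep (\<lambda>n. Abs_fps (\<lambda>j. of_real (a n) ^ j / (l - z n) ^ Suc j))"

lemma cmod_T_coeff:
  assumes "0 \<le> t"
  shows "cmod (fps_nth (fps_const (exp (t * z n)) * fps_exp (complex_of_real (t * a n))) j)
    = exp (- (a n * t)) * ((a n * t) ^ j / fact j)"
proof -
  have "cmod (complex_of_real (t * a n)) = a n * t"
    using assms a_pos[of n] by (simp add: norm_mult)
  then show ?thesis
    by (simp add: norm_mult norm_divide norm_power Re_z mult.commute del: of_real_mult)
qed

lemma T_block_contraction:
  assumes "0 \<le> t"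
  shows "block_norm n (T t f) \<le> block_norm n f"
proof -
  have "(\<Sum>j<d n. (a n * t) ^ j / fact j) \<le> exp (a n * t)"
    unfolding exp_def using summable_exp_generic[of "a n * t"] assms a_pos[of n]
    by (auto simp: divide_inverse mult.commute intro!: sum_le_suminf)
  then have "exp (- (a n * t)) * (\<Sum>j<d n. (a n * t) ^ j / fact j) \<le> 1"
    by (simp add: exp_minus field_simps)
  then show ?thesis
    unfolding T_def using block_norm_toep[where b = 1] assms
    by (simp add: cmod_T_coeff sum_distrib_left del: of_real_mult fps_mult_left_const_nth)
qed

lemma T_coeff_deriv:
  "((\<lambda>h. fps_nth (fps_const (exp (h * z n)) * fps_exp (complex_of_real (h * a n)) - 1) j / h)
     \<longlongrightarrow> fps_nth (fps_const (z n) + fps_const (of_real (a n)) * fps_X) j) (at_right 0)"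
proof -
  \<comment> \<open>The parameter is taken complex so that the complex derivative rules apply; the
    limit is afterwards restricted to positive reals.\<close>
  define G where "G h = exp (h * z n) * (h * a n) ^ j / fact j" for h :: complex
  have "(G has_field_derivative (fps_nth (fps_const (z n) + fps_const (of_real (a n)) * fps_X) j)) (at 0)"
  proof (cases j)
    case 0
    then show ?thesis unfolding G_def by (auto intro!: derivative_eq_intros)
  next
    case (Suc i)
    then show ?thesis unfolding G_def
      \<comment> \<open>The coefficient of index \<open>1\<close> has derivative \<open>a n\<close>;
        the higher ones vanish to at least second order at \<open>0\<close>.\<close>
      by (cases i) (auto intro!: derivative_eq_intros simp del: fact_Suc)
  qed
  then have "((\<lambda>h. (G h - G 0) / h) \<longlongrightarrow> fps_nth (fps_const (z n) + fps_const (of_real (a n)) * fps_X) j) (at 0)"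
    by (simp add: has_field_derivative_iff)
  moreover have "filterlim complex_of_real (at 0) (at_right 0)"
    by (auto simp: filterlim_at eventually_at_filter intro!: tendsto_eq_intros)
  ultimately have "((\<lambda>h. (G (complex_of_real h) - G 0) / h) \<longlongrightarrow> fps_nth (fps_const (z n) + fps_const (of_real (a n)) * fps_X) j) (at_right 0)"
    by (rule filterlim_compose)
  moreover have "G (complex_of_real h) - G 0 = fps_nth (fps_const (exp (h * z n)) * fps_exp (complex_of_real (h * a n)) - 1) j" for h :: real
    by (cases j) (simp_all add: G_def del: fact_Suc)
  ultimately show ?thesis by simp
qed

sublocale ell1_semigroup blocks block_norm "\<lambda>n. 1 + w n * q n ^ d n" T A
proof
  fix f :: "real \<Rightarrow> complex" and s t :: real and n
  show "block_norm n (T t f) \<le> block_norm n f" if "0 \<le> t" by (rule T_block_contraction[OF that])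
  show "T t (\<lambda>x. f x + g x) = (\<lambda>x. T t f x + T t g x)" for g by (simp add: T_def toep_add)
  show "T t (\<lambda>x. c * f x) = (\<lambda>x. c * T t f x)" for c by (simp add: T_def toep_smult)
  assume f: "supported f"
  show "supported (T t f)" "supported (A f)" by (simp_all add: T_def A_def toep_supported)
  show "T 0 f = f" by (simp add: T_def toep_one f)
  have "fps_const (exp (of_real (s + t) * z n)) * fps_exp (complex_of_real ((s + t) * a n))
    = (fps_const (exp (s * z n)) * fps_exp (complex_of_real (s * a n))) *
      (fps_const (exp (t * z n)) * fps_exp (complex_of_real (t * a n)))" for n
  proof -
    have "fps_exp (complex_of_real ((s + t) * a n)) = fps_exp (complex_of_real (s * a n)) * fps_exp (complex_of_real (t * a n))"
      by (simp add: fps_exp_add_mult[symmetric] algebra_simps)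
    moreover have "fps_const (exp (of_real (s + t) * z n)) = fps_const (exp (s * z n)) * fps_const (exp (t * z n))"
      by (simp add: fps_const_mult[symmetric] exp_add algebra_simps del: fps_const_mult) 
    ultimately show ?thesis by (simp only: mult_ac)
  qed
  then show "T (s + t) f = T s (T t f)" by (simp add: T_def toep_toep)
  show "((\<lambda>h. (T h f x - f x) / complex_of_real h) \<longlongrightarrow> A f x) (at_right 0)" for x
  proof (cases "\<exists>n k. k < d n \<and> x = coord n k")
    case True
    then obtain n k where x: "k < d n" "x = coord n k" by auto
    let ?c = "\<lambda>h::real. \<lambda>n. fps_const (exp (h * z n)) * fps_exp (complex_of_real (h * a n))"
    have "T h f x - f x = toep (\<lambda>n. ?c h n - 1) f x" for h
      unfolding T_def toep_fps_diff using toep_one[OF f] by simp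
    then have "(T h f x - f x) / h = (\<Sum>j<d n - k. fps_nth (?c h n - 1) j / h * f (coord n (k + j)))" for h
      using x by (simp add: toep_coord sum_divide_distrib)
    then show ?thesis
      using x unfolding A_def by (simp only: toep_coord if_True) (intro tendsto_intros T_coeff_deriv)
  next
    case False
    then have "T h f x = 0" "A f x = 0" "f x = 0" for h
      using f by (auto simp: T_def A_def toep_outside supported_iff)
    then show ?thesis by simp
  qed
qed

lemma R_fps:
  assumes "l \<noteq> z n"
  shows "Abs_fps (\<lambda>j. of_real (a n) ^ j / (l - z n) ^ Suc j) * (fps_const l - (fps_const (z n) + fps_const (of_real (a n)) * fps_X)) = 1"
proof (rule fps_ext)
  fix j
  let ?r = "Abs_fps (\<lambda>j. of_real (a n) ^ j / (l - z n) ^ Suc j)"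
  have "?r * (fps_const l - (fps_const (z n) + fps_const (of_real (a n)) * fps_X))
      = fps_const (l - z n) * ?r - fps_const (of_real (a n)) * (fps_X * ?r)"
    unfolding fps_const_sub[symmetric] by (simp only: ring_distribs mult_ac diff_diff_eq)
  then show "fps_nth (?r * (fps_const l - (fps_const (z n) + fps_const (of_real (a n)) * fps_X))) j = fps_nth 1 j"
    using assms by (cases j) simp_all
qed

lemma resolvent_jordan:
  assumes "\<And>n. l \<noteq> z n" "0 \<le> c"
    and "\<And>n f. block_norm n (R l f) \<le> c * block_norm n f"
  shows "l \<in> resolvent_set X (generator X T)" "op_norm X (resolvent X l (generator X T)) \<le> ereal c"
proof -
  let ?r = "\<lambda>n. Abs_fps (\<lambda>j. of_real (a n) ^ j / (l - z n) ^ Suc j)"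
  let ?e = "\<lambda>n. fps_const l - (fps_const (z n) + fps_const (of_real (a n)) * fps_X)"
  have lA: "(\<lambda>x. l * f x - A f x) = toep ?e f" if "supported f" for f
    using toep_fps_const[of l "\<lambda>n. 1" f] toep_one[OF that] by (simp add: toep_fps_diff A_def)
  have left: "R l (\<lambda>x. l * f x - A f x) = f" if "supported f" for f
    unfolding lA[OF that] R_def toep_toep R_fps[OF assms(1)] by (rule toep_one[OF that])
  \<comment> \<open>Power series commute, so the left inverse is also a right inverse.\<close>
  have right: "(\<lambda>x. l * R l f x - A (R l f) x) = f" if "supported f" for f
  proof -
    have "supported (R l f)" by (simp add: R_def toep_supported)
    then show ?thesis
      using R_fps[OF assms(1)] toep_one[OF that]
      by (simp only: lA) (simp only: R_def toep_toep mult.commute[of "?e _"])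
  qed
  show "l \<in> resolvent_set X (generator X T)" "op_norm X (resolvent X l (generator X T)) \<le> ereal c"
    using resolventI[of "R l" c l] assms(2,3) left right
    by (auto simp: R_def toep_supported toep_add toep_smult)
qed

end

section \<open>Poisson averages and resolvent estimates\<close>

lemma geometric_le:
  fixes r s :: real
  assumes "0 \<le> r" "r < s"
  shows "(\<Sum>j<m. r ^ j / s ^ Suc j) \<le> 1 / (s - r)"
proof -
  have "(s - r) * (\<Sum>j<m. r ^ j / s ^ Suc j) = 1 - (r / s) ^ m"
  proof (induction m)
    case (Suc m)
    have "(s - r) * (r ^ m / s ^ Suc m) = (r / s) ^ m - (r / s) ^ Suc m"
      using assms by (simp add: field_simps)
    with Suc show ?case by (simp add: distrib_left)
  qed simp
  also have "\<dots> \<le> 1" using assms by simp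
  finally show ?thesis using assms by (simp add: field_simps)
qed

text \<open>The weights satisfy \<open>(j + 1) p (j + 1) = x p j\<close>, so an index shift reduces
  the first and second moments to lower ones.\<close>

lemma poisson_variance:
  fixes x :: real
  shows "(\<lambda>j. (real j - x)\<^sup>2 * (x ^ j / fact j)) sums (x * exp x)"
proof -
  define p where "p j = x ^ j / fact j" for j
  have p0: "p sums exp x"
    using exp_converges[of x] by (simp add: p_def[abs_def] divide_inverse mult.commute)
  have Suc: "real (Suc j) * p (Suc j) = x * p j" for j
    by (simp add: p_def del: of_nat_Suc)
  have "(\<lambda>j. real (Suc j) * p (Suc j)) sums (x * exp x)"
    unfolding Suc by (rule sums_mult[OF p0])
  then have p1: "(\<lambda>j. real j * p j) sums (x * exp x)"
    by (subst (asm) sums_Suc_iff) simp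
  have "(\<lambda>j. real (Suc j) * (real (Suc j) * p (Suc j))) sums (x * (x * exp x) + x * exp x)"
    unfolding Suc using sums_add[OF sums_mult[OF p1, of x] sums_mult[OF p0, of x]]
    by (simp add: algebra_simps)
  then have p2: "(\<lambda>j. real j * (real j * p j)) sums (x * (x * exp x) + x * exp x)"
    by (subst (asm) sums_Suc_iff) simp
  have "(\<lambda>j. real j * (real j * p j) - 2 * x * (real j * p j) + x\<^sup>2 * p j)
      sums (x * (x * exp x) + x * exp x - 2 * x * (x * exp x) + x\<^sup>2 * exp x)"
    by (intro sums_add sums_diff sums_mult p0 p1 p2)
  then show ?thesis
    by (simp add: p_def[symmetric] power2_eq_square algebra_simps)
qed

text \<open>The window covers two standard deviations on either side of the mean, so its complement
  carries at most \<open>1/4\<close> of the mass \<open>exp x\<close>.\<close>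

lemma poisson_chebyshev:
  fixes x :: real
  assumes "0 < x" "finite W" and W: "\<And>j. \<bar>real j - x\<bar> \<le> 2 * sqrt x \<Longrightarrow> j \<in> W"
  shows "3 / 4 * exp x \<le> (\<Sum>j\<in>W. x ^ j / fact j)"
proof -
  define p where "p j = x ^ j / fact j" for j
  have p_nonneg: "0 \<le> p j" for j using assms by (simp add: p_def)
  have p0: "p sums exp x"
    using exp_converges[of x] by (simp add: p_def[abs_def] divide_inverse mult.commute)
  have W_sums: "(\<lambda>j. if j \<in> W then p j else 0) sums (\<Sum>j\<in>W. p j)"
    by (rule sums_If_finite_set[OF assms(2)])
  have "exp x - (\<Sum>j\<in>W. p j) \<le> x * exp x / (4 * x)"
  proof (rule sums_le)
    show "(\<lambda>j. p j - (if j \<in> W then p j else 0)) sums (exp x - (\<Sum>j\<in>W. p j))"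
      by (rule sums_diff[OF p0 W_sums])
    show "(\<lambda>j. (real j - x)\<^sup>2 * p j / (4 * x)) sums (x * exp x / (4 * x))"
      unfolding p_def by (intro sums_divide poisson_variance)
    show "p j - (if j \<in> W then p j else 0) \<le> (real j - x)\<^sup>2 * p j / (4 * x)" for j
    proof (cases "j \<in> W")
      case False
      then have "(2 * sqrt x)\<^sup>2 \<le> \<bar>real j - x\<bar>\<^sup>2"
        using W[of j] assms(1) by (intro power_mono) force+
      then have "4 * x \<le> (real j - x)\<^sup>2" using assms(1) by (simp add: power_mult_distrib)
      then have "4 * x * p j \<le> (real j - x)\<^sup>2 * p j"
        by (intro mult_right_mono p_nonneg)
      then show ?thesis using False assms(1) by (simp add: field_simps)
    qed (use p_nonneg assms in simp)
  qed
  then show ?thesis using assms(1) by (simp add: p_def)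
qed

text \<open>For \<open>4 \<le> x\<close> one has \<open>2 * sqrt x \<le> x\<close>, so the window
  lies in \<open>[0, 2 * x]\<close>, and the \<open>1\<close> in the count
  \<open>4 * sqrt x + 1\<close> is absorbed by \<open>sqrt x\<close>.\<close>

lemma card_window_le:
  fixes x :: real
  assumes "4 \<le> x"
  shows "real (card {j::nat. \<bar>real j - x\<bar> \<le> 2 * sqrt x}) \<le> 5 * sqrt x"
    and "finite {j::nat. \<bar>real j - x\<bar> \<le> 2 * sqrt x}"
    and "\<bar>real j - x\<bar> \<le> 2 * sqrt x \<Longrightarrow> real j \<le> 2 * x"
proof -
  have s: "2 \<le> sqrt x" using assms by (simp add: real_le_rsqrt)
  have "2 * sqrt x \<le> sqrt x * sqrt x" using s assms by (intro mult_right_mono) auto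
  then have s': "2 * sqrt x \<le> x" using assms by simp
  let ?lo = "nat \<lceil>x - 2 * sqrt x\<rceil>" and ?hi = "nat \<lfloor>x + 2 * sqrt x\<rfloor>"
  have sub: "{j::nat. \<bar>real j - x\<bar> \<le> 2 * sqrt x} \<subseteq> {?lo..?hi}"
    by (auto simp: abs_le_iff nat_le_iff le_nat_iff ceiling_le_iff le_floor_iff)
  then show "finite {j::nat. \<bar>real j - x\<bar> \<le> 2 * sqrt x}" by (rule finite_subset) simp
  have "card {j::nat. \<bar>real j - x\<bar> \<le> 2 * sqrt x} \<le> Suc ?hi - ?lo"
    using card_mono[OF _ sub] by simp
  moreover have "?lo \<le> Suc ?hi" using assms s by linarith
  ultimately have "real (card {j::nat. \<bar>real j - x\<bar> \<le> 2 * sqrt x}) \<le> 1 + real ?hi - real ?lo"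
    by linarith
  moreover have "real ?hi \<le> x + 2 * sqrt x" "real ?lo \<ge> x - 2 * sqrt x"
    using assms s by linarith+
  ultimately show "real (card {j::nat. \<bar>real j - x\<bar> \<le> 2 * sqrt x}) \<le> 5 * sqrt x"
    using s by linarith
  show "\<bar>real j - x\<bar> \<le> 2 * sqrt x \<Longrightarrow> real j \<le> 2 * x" using s' by linarith
qed

section \<open>Resolvent bounds and a lower bound for the decay\<close>

context jordan_blocks
begin

lemma R_coeff: "cmod (fps_nth (Abs_fps (\<lambda>j. of_real (a n) ^ j / (l - z n) ^ Suc j)) j)
    = a n ^ j / cmod (l - z n) ^ Suc j"
  using a_pos[of n] by (simp add: norm_mult norm_divide norm_power)

lemma R_far:
  assumes "2 * a n \<le> cmod (l - z n)"
  shows "block_norm n (R l f) \<le> 1 / a n * block_norm n f"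
proof -
  have "(\<Sum>j<d n. a n ^ j / cmod (l - z n) ^ Suc j) \<le> 1 / (cmod (l - z n) - a n)"
    using a_pos[of n] assms by (intro geometric_le) auto
  also have "\<dots> \<le> 1 / a n"
    using a_pos[of n] assms by (intro divide_left_mono) auto
  finally show ?thesis
    unfolding R_def by (intro block_norm_toep) (simp only: R_coeff)
qed

text \<open>The weight satisfies \<open>a n / q n = a n - b\<close>, so in the weighted l1-norm
  \<open>a n J\<close> has norm at most \<open>a n - b\<close> and the Neumann series retains a gap
  of \<open>b / 2\<close>. The maximum norm is reached through the weighted sum, which costs
  \<open>1 / w n\<close>.\<close>

lemma R_near:
  assumes "0 < b" "b < a n" "q n = a n / (a n - b)" "a n - b / 2 \<le> cmod (l - z n)"
  shows "block_norm n (R l f) \<le> (2 / a n / w n + 2 / b) * block_norm n f"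
  unfolding R_def
proof (rule block_norm_toep_weighted; (unfold R_coeff)?)
  let ?s = "cmod (l - z n)"
  have s: "0 < ?s" "a n - b < ?s" "a n / 2 \<le> ?s" using assms(1,2,4) by auto
  have qs: "a n / ?s \<le> q n"
    using assms s a_pos[of n] by (simp add: divide_left_mono)
  fix j
  have "a n ^ j / ?s ^ Suc j = 1 / ?s * (a n / ?s) ^ j" by (simp add: power_divide)
  also have "\<dots> \<le> 2 / a n * q n ^ j"
  proof (intro mult_mono power_mono qs)
    show "1 / ?s \<le> 2 / a n" using s a_pos[of n] by (simp add: field_simps)
  qed (use s a_pos[of n] q_pos[of n] in auto)
  finally show "a n ^ j / ?s ^ Suc j \<le> 2 / a n * q n ^ j" .
next
  let ?s = "cmod (l - z n)"
  have "(\<Sum>j<d n. a n ^ j / ?s ^ Suc j / q n ^ j) = (\<Sum>j<d n. (a n - b) ^ j / ?s ^ Suc j)"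
    using assms a_pos[of n] by (intro sum.cong) (auto simp: power_divide)
  also have "\<dots> \<le> 1 / (?s - (a n - b))"
    using assms by (intro geometric_le) auto
  also have "\<dots> \<le> 1 / (b / 2)"
    using assms by (intro divide_left_mono) auto
  finally show "(\<Sum>j<d n. a n ^ j / ?s ^ Suc j / q n ^ j) \<le> 2 / b" by simp
qed (use a_pos[of n] in simp)

lemma A_le: "block_norm n (A f) \<le> (cmod (z n) + a n) * block_norm n f"
  unfolding A_def
proof (rule block_norm_toep)
  let ?c = "\<lambda>j. cmod (fps_nth (fps_const (z n) + fps_const (of_real (a n)) * fps_X) j)"
  \<comment> \<open>Two more indices ensure that the coefficients \<open>0\<close> and
    \<open>1\<close> occur even when \<open>d n = 1\<close>.\<close>
  have "(\<Sum>j<d n. ?c j) \<le> (\<Sum>j<Suc (Suc (d n)). ?c j)"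
    by (intro sum_mono2) auto
  also have "\<dots> = cmod (z n) + a n"
    using a_pos[of n] by (simp add: sum.lessThan_Suc_shift del: sum.lessThan_Suc)
  finally show "(\<Sum>j<d n. ?c j) \<le> cmod (z n) + a n" .
qed

lemma single_block:
  assumes "supported f" "\<And>m. m \<noteq> n \<Longrightarrow> block_norm m f = 0"
  shows "f \<in> E" "N f = block_norm n f"
proof -
  have "(\<lambda>m. block_norm m f) sums block_norm n f"
    using sums_finite[of "{n}" "\<lambda>m. block_norm m f"] assms(2) by auto
  then show "f \<in> E" "N f = block_norm n f"
    using assms(1) by (auto simp: E_def N_def sums_iff)
qed

text \<open>The test vector is \<open>A g\<close>, with \<open>g\<close> a multiple of the indicator
  \<open>f\<close> of the Poisson window. The window lies below \<open>2 * (a n * t)\<close>, so its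
  weights are at most \<open>exp (2 * (a n * t) * y)\<close> and \<open>B\<close> bounds the norm of
  \<open>f\<close>. At time \<open>t\<close> the entry at \<open>0\<close> collects at least
  \<open>3/4\<close> of the Poisson mass.\<close>

lemma op_norm_ge:
  assumes inv: "0 \<in> resolvent_set X (generator X T)"
    and t: "0 \<le> t" "4 \<le> a n * t" "2 * (a n * t) < real (d n)"
    and q: "q n \<le> exp y"
    and B: "1 + 5 * w n * sqrt (a n * t) * exp (2 * (a n * t) * y) \<le> B"
  shows "ereal (cmod c * (3 / 4) / ((cmod (z n) + a n) * B)) \<le>
    op_norm X (\<lambda>x. c \<odot>\<^bsub>X\<^esub> T t (op_inverse (generator X T) x))"
proof -
  let ?x = "a n * t"
  define W where "W = {j::nat. \<bar>real j - ?x\<bar> \<le> 2 * sqrt ?x}"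
  note W = card_window_le[OF t(2), folded W_def]
  define f :: "real \<Rightarrow> complex" where "f = (\<lambda>x. if x \<in> coord n ` W then 1 else 0)"
  have fc: "f (coord m k) = (if m = n \<and> k \<in> W then 1 else 0)" for m k
    by (auto simp: f_def)
  have Wd: "W \<subseteq> {..<d n}" using W(3) t(3) by (force simp: W_def)
  have sf: "supported f" using Wd by (auto simp: supported_iff f_def)
  have y: "0 \<le> y" using q q_ge_1[of n] order_trans[of 1 "q n" "exp y"] by simp
  have other: "block_norm m f = 0" if "m \<noteq> n" for m
  proof -
    have "(\<lambda>k. cmod (f (coord m k))) ` {..<d m} = {0}"
      using that d_pos[of m] by (auto simp: fc)
    then show ?thesis using that by (simp add: block_norm_def block_max_def block_sum_def fc)
  qed
  have "block_norm n f \<le> 1 + w n * (5 * sqrt ?x * exp (2 * ?x * y))"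
  proof (rule block_norm_le)
    show "block_max n f \<le> 1" by (rule block_max_le) (simp add: fc)
    have "block_sum n f = (\<Sum>k\<in>W. q n ^ k)"
      unfolding block_sum_def using Wd by (intro sum.mono_neutral_cong_right) (auto simp: fc)
    also have "\<dots> \<le> (\<Sum>k\<in>W. exp (2 * ?x * y))"
    proof (rule sum_mono)
      fix k assume "k \<in> W"
      then have "real k * y \<le> 2 * ?x * y" using W(3)[of k] y by (intro mult_right_mono) (auto simp: W_def)
      moreover have "q n ^ k \<le> exp y ^ k" using q q_pos[of n] by (intro power_mono) auto
      ultimately show "q n ^ k \<le> exp (2 * ?x * y)"
        by (simp add: exp_of_nat_mult[symmetric]) (metis exp_le_cancel_iff order_trans)
    qed
    also have "\<dots> \<le> 5 * sqrt ?x * exp (2 * ?x * y)"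
      using W(1) by simp
    finally show "block_sum n f \<le> 5 * sqrt ?x * exp (2 * ?x * y)" .
  qed
  with B have fB: "block_norm n f \<le> B" by (simp add: mult_ac)
  have f1: "1 \<le> B"
    using w_pos[of n] t(2) by (intro order_trans[OF _ B]) simp
  have Af: "block_norm m (A f) = 0" if "m \<noteq> n" for m
    using A_le[of m f] other[OF that] p_nonneg[of m "A f"] by simp
  have fE: "f \<in> E" by (rule single_block(1)[OF sf other])
  have AfE: "A f \<in> E" "N (A f) = block_norm n (A f)"
    using single_block[of "A f" n] A_supported[OF sf] Af by auto
  have Tf: "3 / 4 \<le> cmod (T t f (coord n 0))"
  proof -
    have "T t f (coord n 0) = (\<Sum>j<d n. exp (t * z n) * (complex_of_real (t * a n) ^ j / fact j) * f (coord n j))"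
      using d_pos[of n] by (simp add: T_def toep_coord)
    also have "\<dots> = (\<Sum>j\<in>W. exp (t * z n) * (complex_of_real (t * a n) ^ j / fact j))"
      using Wd by (intro sum.mono_neutral_cong_right) (auto simp: fc)
    also have "\<dots> = exp (t * z n) * of_real (\<Sum>j\<in>W. ?x ^ j / fact j)"
      by (simp add: sum_distrib_left mult.commute)
    finally have "T t f (coord n 0) = exp (t * z n) * of_real (\<Sum>j\<in>W. ?x ^ j / fact j)" .
    moreover have S: "3 / 4 * exp ?x \<le> (\<Sum>j\<in>W. ?x ^ j / fact j)"
      using t(2) W(2) by (intro poisson_chebyshev) (auto simp: W_def)
    moreover have "0 \<le> (\<Sum>j\<in>W. ?x ^ j / fact j)" using t(2) by (intro sum_nonneg) auto
    ultimately have "cmod (T t f (coord n 0)) = exp (- ?x) * (\<Sum>j\<in>W. ?x ^ j / fact j)"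
      by (simp only: norm_mult norm_exp_eq_Re norm_of_real abs_of_nonneg) (simp add: Re_z mult.commute)
    moreover have "exp (- ?x) * (3 / 4 * exp ?x) \<le> exp (- ?x) * (\<Sum>j\<in>W. ?x ^ j / fact j)"
      using S by (intro mult_left_mono) auto
    moreover have "exp (- ?x) * (3 / 4 * exp ?x) = 3 / 4" by (simp add: exp_minus)
    ultimately show ?thesis by linarith
  qed
  \<comment> \<open>By \<open>A_le\<close>, \<open>D\<close> bounds the norm of \<open>A f\<close>;
    dividing by it puts \<open>A g\<close> into the unit ball.\<close>
  define D where "D = (cmod (z n) + a n) * B"
  have D: "0 < D" using f1 a_pos[of n] by (auto simp: D_def intro!: mult_pos_pos add_nonneg_pos)
  define g where "g = (\<lambda>x. of_real (1 / D) * f x)"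
  have gE: "g \<in> E" unfolding g_def by (rule E_smult[OF fE])
  have Ag: "A g = (\<lambda>x. of_real (1 / D) * A f x)" unfolding g_def A_def by (rule toep_smult)
  then have AgE: "A g \<in> E" by (simp only: E_smult[OF AfE(1)])
  have "N (A f) \<le> D"
    unfolding AfE(2) D_def using fB a_pos[of n]
    by (intro order_trans[OF A_le] mult_left_mono add_nonneg_nonneg) auto
  moreover have "N (A g) = N (A f) / D"
    using XS.nrm_smult[of "A f" "of_real (1 / D)"] AfE(1) D by (simp add: Ag norm_divide)
  ultimately have NAg: "N (A g) \<le> 1" using D by simp
  have "cmod c * (3 / 4) / D \<le> N (\<lambda>x. c * T t g x)"
  proof -
    have "(\<lambda>x. c * T t g x) \<in> E" by (intro E_smult T_in_E gE t)
    from cmod_le_N[OF this, of "coord n 0"]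
    have "cmod (c * T t g (coord n 0)) \<le> N (\<lambda>x. c * T t g x)" .
    moreover have "cmod (c * T t g (coord n 0)) = cmod c * cmod (T t f (coord n 0)) / D"
      unfolding g_def T_smult using D by (simp add: norm_mult norm_divide)
    moreover have "cmod c * (3 / 4) / D \<le> cmod c * cmod (T t f (coord n 0)) / D"
      using Tf D by (intro divide_right_mono mult_left_mono) auto
    ultimately show ?thesis by linarith
  qed
  then have "ereal (cmod c * (3 / 4) / D) \<le> ereal (nrm X (c \<odot>\<^bsub>X\<^esub> T t (op_inverse (generator X T) (A g))))"
    using op_inverse_generator[OF inv gE AgE] by simp
  also have "\<dots> \<le> op_norm X (\<lambda>x. c \<odot>\<^bsub>X\<^esub> T t (op_inverse (generator X T) x))"
    unfolding op_norm_def by (rule SUP_upper) (use AgE NAg in auto)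
  finally show ?thesis by (simp add: D_def)
qed

end

section \<open>Choice of frequencies\<close>

text \<open>Otherwise \<open>F\<close> would gain a factor \<open>exp (2 * \<alpha>)\<close> on
  every unit step beyond \<open>S\<close>, against growth of order
  \<open>exp (\<alpha> * s)\<close>.\<close>

lemma unit_step_doubling:
  fixes F :: "real \<Rightarrow> real"
  assumes "F \<in> O[at_top](\<lambda>s. exp (\<alpha> * s))" "0 < \<alpha>" and pos: "\<And>s. 0 < s \<Longrightarrow> 0 < F s"
  shows "\<exists>s\<ge>S. F s \<le> exp (2 * \<alpha>) * F (s - 1)"
proof (rule ccontr)
  assume "\<not> ?thesis"
  then have step: "F s > exp (2 * \<alpha>) * F (s - 1)" if "s \<ge> S" for s using that by force
  define r where "r = max S 1"
  have "F (r + real m) \<ge> exp (2 * \<alpha> * real m) * F r" for m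
  proof (induction m)
    case (Suc m)
    have "exp (2 * \<alpha> * real (Suc m)) * F r = exp (2 * \<alpha>) * (exp (2 * \<alpha> * real m) * F r)"
      by (simp add: exp_add[symmetric] algebra_simps)
    also have "\<dots> \<le> exp (2 * \<alpha>) * F (r + real m)" using Suc by (intro mult_left_mono) auto
    also have "\<dots> \<le> F (r + real (Suc m))"
    proof -
      have "S \<le> r + real (Suc m)" by (simp add: r_def)
      from step[OF this] show ?thesis by (simp add: algebra_simps)
    qed
    finally show ?case .
  qed simp
  moreover from assms(1) obtain c where c: "c > 0" "\<forall>\<^sub>F s in at_top. norm (F s) \<le> c * norm (exp (\<alpha> * s))"
    by (auto elim: landau_o.bigE)
  moreover have "filterlim (\<lambda>m. r + real m) at_top sequentially"
    by real_asymp
  from eventually_compose_filterlim[OF c(2) this]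
  have "\<forall>\<^sub>F m in sequentially. F (r + real m) \<le> c * exp (\<alpha> * (r + real m))"
    by (auto elim: eventually_mono)
  ultimately have "\<forall>\<^sub>F m in sequentially. exp (2 * \<alpha> * real m) * F r \<le> c * exp (\<alpha> * (r + real m))"
    by (auto elim!: eventually_mono intro: order_trans)
  moreover have "0 < F r" using pos[of r] by (simp add: r_def)
  then have "\<forall>\<^sub>F m in sequentially. exp (2 * \<alpha> * real m) * F r > c * exp (\<alpha> * (r + real m))"
    using c(1) assms(2) by real_asymp
  ultimately have "\<forall>\<^sub>F m in sequentially. False" by eventually_elim linarith
  then show False by simp
qed

section \<open>Pairs of growth functions and tame frequencies\<close>

locale growth_pair =
  fixes M K :: "real \<Rightarrow> real"
  assumes M_pos: "0 \<le> s \<Longrightarrow> 0 < M s" and M_mono: "0 \<le> r \<Longrightarrow> r \<le> s \<Longrightarrow> M r \<le> M s"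
    and K_mono: "0 \<le> r \<Longrightarrow> r \<le> s \<Longrightarrow> K r \<le> K s" and M_le_K: "0 \<le> s \<Longrightarrow> M s \<le> K s"
begin

lemma K_pos: "0 \<le> s \<Longrightarrow> 0 < K s"
  using M_pos[of s] M_le_K[of s] by linarith

lemma MK_strict_mono: "0 \<le> r \<Longrightarrow> r < s \<Longrightarrow> MK M K r < MK M K s"
  unfolding MK_def using M_pos[of r] M_mono[of r s] K_mono[of r s] K_pos[of r]
  by (intro mult_le_less_imp_less add_less_le_mono) auto

lemma MK_pos: "0 \<le> s \<Longrightarrow> 0 < MK M K s"
  unfolding MK_def using M_pos[of s] K_pos[of s] by (intro mult_pos_pos add_nonneg_pos) auto

lemma MK_inv_MK: "0 \<le> s \<Longrightarrow> MK_inv M K (MK M K s) = s"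
  unfolding MK_inv_def
  by (rule the_inv_into_f_f) (auto intro!: linorder_inj_onI dest: MK_strict_mono)

lemma MK_at_top: "filterlim (MK M K) at_top at_top"
proof (rule filterlim_at_top_mono)
  show "filterlim (\<lambda>s. M 0 * ln (1 + s)) at_top at_top"
    using M_pos[of 0] by real_asymp
  show "\<forall>\<^sub>F s in at_top. M 0 * ln (1 + s) \<le> MK M K s"
    using eventually_ge_at_top[of 0]
  proof eventually_elim
    case (elim s)
    then show ?case unfolding MK_def using M_pos[of 0] M_mono[of 0 s] K_pos[of s]
      by (intro mult_mono) auto
  qed
qed

text \<open>For \<open>t = M\<^sub>K(s)\<close>, tameness bounds the norm of the test vector in a block with frequency \<open>s\<close> and
  bandwidth \<open>r\<close>: the window has width of order \<open>(t r)\<^sup>1\<^sup>/\<^sup>2\<close>, and the exponential is the weight accumulated up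
  to time \<open>t\<close>.\<close>

definition tame :: "real \<Rightarrow> real \<Rightarrow> real \<Rightarrow> real \<Rightarrow> bool" where
  "tame C \<delta> s r \<longleftrightarrow> 1 \<le> r \<and> r \<le> s \<and>
     sqrt (MK M K s / r) * exp (8 * MK M K s / (\<delta> * M (s - r))) \<le> C * K (s - r)"

text \<open>The bandwidth is \<open>s / 2\<close>. As \<open>K s \<le> s\<close>,
  \<open>MK M K s\<close> is at most \<open>4 * M (s / 2) * ln (1 + s)\<close>. For
  \<open>256 \<le> \<delta>\<close> the exponential is then at most
  \<open>(1 + s) powr (1/8)\<close>, while the square root decays like \<open>s powr (-3/8)\<close>
  up to a logarithm. The constant \<open>1 / K 0\<close> makes the right-hand side at least
  \<open>1\<close>.\<close>

lemma tame_slow: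
  assumes slow: "\<And>S. \<exists>s\<ge>S. M s \<le> 2 * M (s / 2) \<and> K s \<le> s powr (1/4)" and "256 \<le> \<delta>"
  shows "\<exists>s\<ge>S. \<exists>r. tame (1 / K 0) \<delta> s r"
proof -
  have "\<forall>\<^sub>F s in at_top. sqrt (4 * s powr (1/4) * ln (1 + s) / s) * (1 + s) powr (1/8) \<le> 1"
    by real_asymp
  then obtain S1 where S1: "\<And>s. s \<ge> S1 \<Longrightarrow> sqrt (4 * s powr (1/4) * ln (1 + s) / s) * (1 + s) powr (1/8) \<le> 1"
    by (auto simp: eventually_at_top_linorder)
  obtain s where s: "s \<ge> max S (max S1 2)" "M s \<le> 2 * M (s / 2)" "K s \<le> s powr (1/4)"
    using slow by blast
  then have s2: "2 \<le> s" by simp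
  define t where "t = MK M K s"
  have "s powr (1/4) \<le> s powr 1" using s2 by (intro powr_mono) auto
  then have "ln (1 + K s) \<le> ln (1 + s)" using s s2 K_pos[of s] by simp
  then have t: "t \<le> 2 * M s * ln (1 + s)"
    unfolding t_def MK_def using M_pos[of s] s2 by (simp add: mult_left_mono[of "_ + _" "2 * _" "M s", simplified])
  have M2: "0 < M (s / 2)" using M_pos s2 by simp
  have "8 * t / (\<delta> * M (s / 2)) \<le> 8 * (2 * (2 * M (s / 2)) * ln (1 + s)) / (\<delta> * M (s / 2))"
    using assms(2) M2 s(2) s2 by (intro divide_right_mono mult_left_mono order_trans[OF t] mult_right_mono) auto
  also have "\<dots> = 32 * ln (1 + s) / \<delta>" using M2 by simp
  also have "\<dots> \<le> 32 * ln (1 + s) / 256" using assms(2) s2 by (intro divide_left_mono) auto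
  finally have "exp (8 * t / (\<delta> * M (s / 2))) \<le> (1 + s) powr (1/8)"
    using s2 by (simp add: powr_def)
  moreover have "sqrt (t / (s / 2)) \<le> sqrt (4 * s powr (1/4) * ln (1 + s) / s)"
  proof -
    have "t \<le> 2 * s powr (1/4) * ln (1 + s)"
      using M_le_K[of s] s s2 by (intro order_trans[OF t] mult_right_mono) auto
    then show ?thesis using s2 by (simp add: field_simps)
  qed
  ultimately have "sqrt (t / (s / 2)) * exp (8 * t / (\<delta> * M (s / 2)))
      \<le> sqrt (4 * s powr (1/4) * ln (1 + s) / s) * (1 + s) powr (1/8)"
    using s2 by (intro mult_mono) auto
  also have "\<dots> \<le> 1" using s by (intro S1) simp
  also have "1 \<le> 1 / K 0 * K (s - s / 2)" using K_pos[of 0] K_mono[of 0 "s - s / 2"] s2 by simp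
  finally show ?thesis
    unfolding tame_def using s s2 by (intro exI[of _ s] exI[of _ "s / 2"] conjI) (auto simp: t_def)
qed

text \<open>The product \<open>K(s) M(s)\<close> is what can be bounded below by halving \<open>s\<close> repeatedly; then
  \<open>K \<ge> M\<close> yields the claim.\<close>

lemma K_power_lower:
  assumes fast: "\<And>s. s \<ge> S \<Longrightarrow> M s > 2 * M (s / 2) \<or> K s > s powr (1/4)" and "0 < S"
  obtains c where "0 < c" "\<And>s. 0 \<le> s \<Longrightarrow> c * s powr (1/8) \<le> K s"
proof -
  \<comment> \<open>The second bound starts the induction below \<open>S\<close>;
    \<open>e \<le> M 0\<close> serves the case in which \<open>K\<close> itself exceeds the
    power.\<close>
  define e where "e = min (M 0) ((M 0)\<^sup>2 / S powr (1/4))"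
  have e: "0 < e" "e \<le> M 0" "e * S powr (1/4) \<le> (M 0)\<^sup>2"
    using M_pos[of 0] assms(2) by (auto simp: e_def min_def field_simps)
  \<comment> \<open>The induction counts the halvings that bring \<open>s\<close> below
    \<open>S\<close>.\<close>
  have KM: "e * s powr (1/4) \<le> K s * M s" if "0 \<le> s" "s < 2 ^ m * S" for s m
    using that
  proof (induction m arbitrary: s)
    case 0
    have "e * s powr (1/4) \<le> e * S powr (1/4)" using 0 e by (intro mult_left_mono powr_mono2) auto
    also have "\<dots> \<le> M 0 * M 0" using e by (simp add: power2_eq_square)
    also have "\<dots> \<le> K s * M s"
      using 0 M_pos[of 0] M_pos[of s] M_le_K[of s] M_mono[of 0 s] by (intro mult_mono) auto
    finally show ?case .
  next
    case (Suc m)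
    show ?case
    proof (cases "s < 2 ^ m * S")
      case True
      then show ?thesis using Suc by blast
    next
      case False
      moreover have "S \<le> 2 ^ m * S" using assms(2) by simp
      ultimately have "s \<ge> S" by linarith
      from fast[OF this] show ?thesis
      proof
        assume "K s > s powr (1/4)"
        moreover have "e \<le> M s" using e M_mono[of 0 s] Suc by auto
        ultimately have "e * s powr (1/4) \<le> M s * K s" using e by (intro mult_mono) auto
        then show ?thesis by (simp add: mult.commute)
      next
        assume M2: "M s > 2 * M (s / 2)"
        have "(s / 2) powr (1/4) * 2 powr (1/4) = s powr (1/4)"
          using Suc.prems by (simp add: powr_mult[symmetric])
        \<comment> \<open>Halving loses only the factor \<open>2 powr (1/4)\<close>, less than the
          factor \<open>2\<close> gained from \<open>M\<close>.\<close>
        moreover have "(s / 2) powr (1/4) * 2 powr (1/4) \<le> (s / 2) powr (1/4) * 2 powr 1"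
          by (intro mult_left_mono powr_mono) auto
        ultimately have "e * s powr (1/4) \<le> 2 * (e * (s / 2) powr (1/4))" using e by simp
        also have "\<dots> \<le> 2 * (K (s / 2) * M (s / 2))" using Suc by simp
        also have "\<dots> = K (s / 2) * (2 * M (s / 2))" by simp
        also have "\<dots> \<le> K s * M s"
          using M2 Suc.prems K_mono[of "s / 2" s] K_pos[of s] M_pos[of "s / 2"] by (intro mult_mono) auto
        finally show ?thesis .
      qed
    qed
  qed
  have "sqrt e * s powr (1/8) \<le> K s" if s: "0 \<le> s" for s
  proof -
    obtain m :: nat where "s / S < 2 ^ m" using real_arch_pow[of 2] by auto
    then have "e * s powr (1/4) \<le> K s * M s"
      using KM[of s m] s assms(2) by (simp add: field_simps)
    also have "\<dots> \<le> K s * K s" using K_pos[OF s] M_le_K[OF s] by simp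
    finally have "e * s powr (1/4) \<le> (K s)\<^sup>2" by (simp add: power2_eq_square)
    moreover have "(s powr (1/8))\<^sup>2 = s powr (1/4)"
      by (simp add: power2_eq_square powr_add[symmetric])
    ultimately have "(sqrt e * s powr (1/8))\<^sup>2 \<le> (K s)\<^sup>2"
      using e by (simp add: power_mult_distrib)
    then show ?thesis using K_pos[OF s] by (simp add: power2_le_iff_abs_le)
  qed
  then show ?thesis using that[of "sqrt e"] e by auto
qed

text \<open>The bandwidth is \<open>1\<close>. With \<open>u = s - 1\<close> and
  \<open>k = 1 + K u\<close>, the power bound gives \<open>ln (1 + u) \<le> 16 * ln k\<close> for
  large \<open>u\<close>, hence \<open>MK M K s \<le> 17 * E * M u * ln k\<close>. The choice
  \<open>1088 = 8 * 8 * 17\<close> keeps the exponential below \<open>k powr (1/8)\<close>; the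
  square root is at most of order \<open>k powr (5/8)\<close>, and
  \<open>k powr (3/4) \<le> k\<close>.\<close>

lemma tame_fast:
  assumes c: "0 < c" "\<And>s. 0 \<le> s \<Longrightarrow> c * s powr (1/8) \<le> K s"
    and "E \<ge> 0" and doubling: "\<And>S. \<exists>s\<ge>S. MK M K s \<le> E * MK M K (s - 1)"
    and \<delta>: "\<delta> > 0" "1088 * E \<le> \<delta>"
  shows "\<exists>s\<ge>S. \<exists>r. tame (sqrt (68 * E) * (1 + 1 / K 0)) \<delta> s r"
proof -
  have "\<forall>\<^sub>F s in at_top. (1 + s) powr (1/16) \<le> c * s powr (1/8)"
    using c(1) by real_asymp
  then obtain S1 where S1: "\<And>s. s \<ge> S1 \<Longrightarrow> (1 + s) powr (1/16) \<le> c * s powr (1/8)"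
    by (auto simp: eventually_at_top_linorder)
  obtain s where s: "s \<ge> max S (max S1 0 + 1)" "MK M K s \<le> E * MK M K (s - 1)"
    using doubling by blast
  define u where "u = s - 1"
  have u: "0 \<le> u" "S1 \<le> u" using s by (auto simp: u_def)
  define k where "k = 1 + K u"
  have k: "1 < k" using K_pos[of u] u by (simp add: k_def)
  define t where "t = MK M K s"
  have "(1 + u) powr (1/16) \<le> k" using S1[OF u(2)] c(2)[OF u(1)] by (simp add: k_def)
  then have "ln ((1 + u) powr (1/16)) \<le> ln k" using u k by (subst ln_le_cancel_iff) auto
  then have "ln (1 + u) \<le> 16 * ln k" using u by (simp add: ln_powr)
  then have "MK M K u \<le> M u * (17 * ln k)"
    unfolding MK_def using M_pos[OF u(1)] by (intro mult_left_mono) (auto simp: k_def)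
  then have "E * MK M K u \<le> E * (M u * (17 * ln k))" using assms(3) by (rule mult_left_mono)
  then have t: "t \<le> 17 * E * M u * ln k" using s(2) by (simp add: t_def u_def algebra_simps)
  have "8 * t / (\<delta> * M u) \<le> 8 * (17 * E * M u * ln k) / (\<delta> * M u)"
    using t \<delta> M_pos[OF u(1)] by (intro divide_right_mono mult_left_mono) auto
  also have "\<dots> = 1088 * E / \<delta> * (ln k / 8)" using M_pos[OF u(1)] \<delta> by (simp add: field_simps)
  also have "\<dots> \<le> 1 * (ln k / 8)" using \<delta> k by (intro mult_right_mono) auto
  finally have e: "exp (8 * t / (\<delta> * M u)) \<le> k powr (1/8)"
    using k by (simp add: powr_def)
  have "ln k = 4 * ln (k powr (1/4))" using k by (simp add: ln_powr)
  also have "\<dots> \<le> 4 * k powr (1/4)" using ln_le_minus_one[of "k powr (1/4)"] k by simp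
  finally have "M u * ln k \<le> k * (4 * k powr (1/4))"
    using M_le_K[OF u(1)] M_pos[OF u(1)] k by (intro mult_mono) (auto simp: k_def)
  then have "17 * E * (M u * ln k) \<le> 17 * E * (k * (4 * k powr (1/4)))"
    using assms(3) by (intro mult_left_mono) auto
  also have "\<dots> = 68 * E * (k powr (5/8))\<^sup>2"
    using k powr_add[of k 1 "1/4"] by (simp add: power2_eq_square powr_add[symmetric])
  finally have "t \<le> 68 * E * (k powr (5/8))\<^sup>2" using t by (simp add: mult.assoc)
  then have "sqrt t \<le> sqrt (68 * E * (k powr (5/8))\<^sup>2)" by simp
  then have "sqrt t \<le> sqrt (68 * E) * k powr (5/8)" by (simp add: real_sqrt_mult)
  with e have "sqrt t * exp (8 * t / (\<delta> * M u)) \<le> sqrt (68 * E) * k powr (5/8) * k powr (1/8)"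
    using assms(3) by (intro mult_mono) auto
  also have "\<dots> = sqrt (68 * E) * k powr (3/4)" by (simp add: mult.assoc powr_add[symmetric])
  also have "\<dots> \<le> sqrt (68 * E) * k powr 1" using k assms(3) by (intro mult_left_mono powr_mono) auto
  also have "\<dots> \<le> sqrt (68 * E) * ((1 + 1 / K 0) * K u)"
  proof (intro mult_left_mono)
    have "1 \<le> K u / K 0" using K_pos[of 0] K_mono[of 0 u] u by simp
    then show "k powr 1 \<le> (1 + 1 / K 0) * K u" using k by (simp add: k_def algebra_simps)
  qed (use assms(3) in simp)
  finally show ?thesis
    unfolding tame_def using s by (intro exI[of _ s] exI[of _ 1] conjI) (auto simp: t_def u_def)
qed

lemma tame_exists:
  assumes "MK M K \<in> O[at_top](\<lambda>s. exp (\<alpha> * s))" "0 < \<alpha>"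
  obtains C \<delta> where "0 < C" "\<And>\<delta>' S. \<delta>' \<ge> \<delta> \<Longrightarrow> \<exists>s\<ge>S. \<exists>r. tame C \<delta>' s r"
proof (cases "\<forall>S. \<exists>s\<ge>S. M s \<le> 2 * M (s / 2) \<and> K s \<le> s powr (1/4)")
  case True
  then show ?thesis using tame_slow that[of "1 / K 0" 256] K_pos[of 0] by auto
next
  case False
  then obtain S where "\<And>s. s \<ge> S \<Longrightarrow> M s > 2 * M (s / 2) \<or> K s > s powr (1/4)"
    by (force simp: not_le)
  then have "\<And>s. s \<ge> max S 1 \<Longrightarrow> M s > 2 * M (s / 2) \<or> K s > s powr (1/4)" by simp
  then obtain c where c: "0 < c" "\<And>s. 0 \<le> s \<Longrightarrow> c * s powr (1/8) \<le> K s"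
    by (rule K_power_lower[of "max S 1"]) auto
  let ?E = "exp (2 * \<alpha>)"
  have "\<exists>s\<ge>S. MK M K s \<le> ?E * MK M K (s - 1)" for S
    by (rule unit_step_doubling) (use assms MK_pos in auto)
  from tame_fast[OF c _ this] 
  have "\<exists>s\<ge>S. \<exists>r. tame (sqrt (68 * ?E) * (1 + 1 / K 0)) \<delta> s r" if "1088 * ?E \<le> \<delta>" for \<delta> S
    using that by (smt (verit) exp_gt_zero)
  moreover have "0 < sqrt (68 * ?E) * (1 + 1 / K 0)"
    using K_pos[of 0] by (intro mult_pos_pos add_pos_pos) auto
  ultimately show ?thesis using that by blast
qed

end

section \<open>The semigroup\<close>

lemma growth_pairI:
  assumes "regularly_growing M" "regularly_growing K" "\<forall>s\<ge>0. K s \<ge> M s"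
  shows "growth_pair M K"
proof
  fix r s :: real
  show "0 < M s" "M s \<le> K s" if "0 \<le> s"
    using that assms by (simp_all add: regularly_growing_def)
  show "M r \<le> M s" "K r \<le> K s" if "0 \<le> r" "r \<le> s"
    using that assms by (simp_all add: regularly_growing_def mono_on_def)
qed

lemma Limsup_pos_of_sequence:
  fixes f :: "real \<Rightarrow> ereal"
  assumes "filterlim t at_top sequentially" "\<And>n. c \<le> f (t n)" "0 < c"
  shows "Limsup at_top f > 0"
proof (rule ccontr)
  assume "\<not> ?thesis"
  then have "Limsup at_top f < c" using assms(3) by (simp add: not_less le_less_trans)
  then have "\<forall>\<^sub>F x in at_top. f x < c" by (rule Limsup_lessD)
  from eventually_compose_filterlim[OF this assms(1)]
  have "\<forall>\<^sub>F n in sequentially. f (t n) < c" .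
  then obtain n where "f (t n) < c" by (auto simp: eventually_sequentially)
  then show False using assms(2)[of n] by simp
qed

text \<open>Converts a weight of the form \<open>1 / (1 - b / a)\<close> into an exponential, as
  \<open>op_norm_ge\<close> expects.\<close>

lemma inverse_one_minus_le_exp:
  fixes y :: real
  assumes "0 \<le> y" "y \<le> 1/2"
  shows "1 / (1 - y) \<le> exp (2 * y)"
proof -
  have "0 \<le> y * (1 - 2 * y)" using assms by simp
  then have "1 \<le> (1 - y) * (1 + 2 * y)" by (simp add: algebra_simps)
  also have "\<dots> \<le> (1 - y) * exp (2 * y)" using assms by (intro mult_left_mono) auto
  finally show ?thesis using assms by (simp add: field_simps)
qed

section \<open>Blocks along a sequence of tame frequencies\<close>

text \<open>\<open>12 / M 0 \<le> \<delta>\<close> will give \<open>b n \<le> a n / 2\<close>, and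
  \<open>12 \<le> MK M K (s n)\<close> with \<open>a n \<ge> 1/3\<close> will give
  \<open>4 \<le> a n * t n\<close>, as the Poisson window requires.\<close>

locale tame_sequence = growth_pair +
  fixes C \<delta> :: real and s r :: "nat \<Rightarrow> real"
  assumes C_pos: "0 < C" and \<delta>_ge: "2 \<le> \<delta>" "12 / M 0 \<le> \<delta>"
    and tame: "tame C \<delta> (s n) (r n)" and s_ge: "real n \<le> s n" and MK_ge: "12 \<le> MK M K (s n)"
begin

text \<open>The disc of radius \<open>3 * a n = r n\<close> about the point \<open>s n\<close> of
  the imaginary axis has imaginary parts at least \<open>u n\<close>. There
  \<open>Omega (\<lambda>s. \<delta> * M s)\<close> reaches at most \<open>b n / 2\<close> into the
  left half-plane. The choice of \<open>w n\<close> turns the cost \<open>2 / a n / w n\<close> in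
  \<open>R_near\<close> into \<open>2 * K (u n)\<close>.\<close>

definition u :: "nat \<Rightarrow> real" where "u n = s n - r n"
definition a :: "nat \<Rightarrow> real" where "a n = r n / 3"
definition b :: "nat \<Rightarrow> real" where "b n = 2 / (\<delta> * M (u n))"
definition t :: "nat \<Rightarrow> real" where "t n = MK M K (s n)"
definition z :: "nat \<Rightarrow> complex" where "z n = Complex (- a n) (s n)"
definition q :: "nat \<Rightarrow> real" where "q n = a n / (a n - b n)"
definition w :: "nat \<Rightarrow> real" where "w n = 1 / (a n * K (u n))"
text \<open>More than \<open>2 * (a n * t n)\<close> entries, so that the Poisson window fits into
  the block.\<close>

definition d :: "nat \<Rightarrow> nat" where "d n = Suc (nat \<lceil>2 * (a n * t n)\<rceil>)"

lemma r_bounds: "1 \<le> r n" "r n \<le> s n"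
  using tame[of n] by (auto simp: tame_def)

lemma a_ge: "1/3 \<le> a n"
  using r_bounds[of n] by (simp add: a_def)

lemma u_nonneg: "0 \<le> u n"
  using r_bounds[of n] by (simp add: u_def)

lemma b_bounds: "0 < b n" "b n \<le> a n / 2"
proof -
  have M: "0 < M 0" "M 0 \<le> M (u n)" using M_pos[of 0] M_mono u_nonneg[of n] by auto
  then show "0 < b n" using \<delta>_ge by (simp add: b_def)
  have "12 \<le> \<delta> * M 0" using \<delta>_ge(2) M by (simp add: field_simps)
  also have "\<dots> \<le> \<delta> * M (u n)" using \<delta>_ge M by simp
  finally have "b n \<le> 2 / 12" unfolding b_def by (intro divide_left_mono) auto
  then show "b n \<le> a n / 2" using a_ge[of n] by simp
qed

sublocale jordan_blocks d q w z a
proof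
  fix n
  show "0 < d n" by (simp add: d_def)
  show "1 \<le> q n" using b_bounds[of n] a_ge[of n] by (simp add: q_def)
  show "0 < w n" using a_ge[of n] K_pos[OF u_nonneg[of n]] by (simp add: w_def)
  show "0 < a n" using a_ge[of n] by simp
  show "Re (z n) = - a n" by (simp add: z_def)
qed

definition D :: real where "D = 3 / K 0 + 2 + \<delta>"

lemma D_pos: "0 < D"
  using K_pos[of 0] \<delta>_ge by (auto simp: D_def intro!: add_nonneg_pos add_pos_pos)

text \<open>Outside the disc of radius \<open>3 * a n\<close> about the frequency,
  \<open>R_far\<close> applies with \<open>1 / a n \<le> 3\<close>. Inside it,
  \<open>u n \<le> Im l\<close>, so monotonicity of \<open>M\<close> supplies the distance for
  \<open>R_near\<close>, and monotonicity of \<open>K\<close> replaces \<open>K (u n)\<close> by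
  \<open>K (Im l)\<close>. The summands of \<open>D\<close> are the constants of the two
  cases.\<close>

lemma resolvent_block:
  assumes l: "l \<in> Omega (\<lambda>s. \<delta> * M s)"
  shows "l \<noteq> z n" "block_norm n (R l f) \<le> D * K \<bar>Im l\<bar> * block_norm n f"
proof -
  have "(cmod (l - z n) > 0) \<and> block_norm n (R l f) \<le> D * K \<bar>Im l\<bar> * block_norm n f"
  proof (cases "3 * a n \<le> cmod (l - Complex 0 (s n))")
    case True
    have "cmod (l - Complex 0 (s n)) \<le> cmod (l - z n) + cmod (complex_of_real (a n))"
      using norm_triangle_ineq4[of "l - z n" "complex_of_real (a n)"]
      by (simp add: z_def complex_eq_iff Complex_eq)
    then have far: "2 * a n \<le> cmod (l - z n)" using True a_pos[of n] by simp
    have "1 / a n \<le> 3" using a_ge[of n] a_pos[of n] by (simp add: field_simps)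
    also have "\<dots> \<le> 3 / K 0 * K \<bar>Im l\<bar>" using K_pos[of 0] K_mono[of 0 "\<bar>Im l\<bar>"] by (simp add: field_simps)
    also have "\<dots> \<le> D * K \<bar>Im l\<bar>" unfolding D_def using \<delta>_ge K_pos[of "\<bar>Im l\<bar>"] by (intro mult_right_mono) auto
    finally have "1 / a n * block_norm n f \<le> D * K \<bar>Im l\<bar> * block_norm n f"
      by (intro mult_right_mono p_nonneg)
    with R_far[OF far, of f] far a_pos[of n] show ?thesis by linarith
  next
    case False
    have "\<bar>Im (l - Complex 0 (s n))\<bar> \<le> cmod (l - Complex 0 (s n))" by (rule abs_Im_le_cmod)
    then have Im: "u n \<le> Im l" using False by (auto simp: a_def u_def)
    then have Im0: "0 \<le> Im l" using u_nonneg[of n] by linarith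
    have M: "0 < M (u n)" "M (u n) \<le> M (Im l)" using M_pos M_mono u_nonneg[of n] Im by auto
    have "b n / 2 = 1 / (\<delta> * M (u n))" by (simp add: b_def)
    also have "\<dots> \<ge> 1 / (\<delta> * M (Im l))" using M \<delta>_ge by (intro divide_left_mono) auto
    finally have "- b n / 2 < Re l" using l Im0 by (simp add: Omega_def)
    then have near: "a n - b n / 2 \<le> cmod (l - z n)"
      using complex_Re_le_cmod[of "l - z n"] by (simp add: z_def)
    have "2 / a n / w n + 2 / b n = 2 * K (u n) + \<delta> * M (u n)"
      using a_pos[of n] \<delta>_ge M K_pos[OF u_nonneg[of n]] by (simp add: w_def b_def field_simps)
    also have "\<dots> \<le> (2 + \<delta>) * K (u n)"
      using M_le_K[OF u_nonneg[of n]] \<delta>_ge by (simp add: algebra_simps)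
    also have "\<dots> \<le> D * K \<bar>Im l\<bar>"
      unfolding D_def using K_mono[OF u_nonneg Im] K_pos[of 0] K_pos[OF u_nonneg[of n]] \<delta>_ge Im0 by (intro mult_mono) auto
    finally have "(2 / a n / w n + 2 / b n) * block_norm n f \<le> D * K \<bar>Im l\<bar> * block_norm n f"
      by (intro mult_right_mono p_nonneg)
    with R_near[OF b_bounds(1) _ q_def near, of f] b_bounds[of n] a_pos[of n] near show ?thesis by linarith
  qed
  then show "l \<noteq> z n" "block_norm n (R l f) \<le> D * K \<bar>Im l\<bar> * block_norm n f" by auto
qed

lemma resolvent_bound:
  assumes l: "l \<in> Omega (\<lambda>s. \<delta> * M s)"
  shows "l \<in> resolvent_set X (generator X T)"
    and "op_norm X (resolvent X l (generator X T)) / ereal (K \<bar>Im l\<bar>) \<le> ereal D"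
proof -
  have K: "0 < K \<bar>Im l\<bar>" by (rule K_pos) simp
  have "0 \<le> D * K \<bar>Im l\<bar>" using D_pos K by simp
  note R = resolvent_jordan[OF resolvent_block(1)[OF l] this resolvent_block(2)[OF l]]
  show "l \<in> resolvent_set X (generator X T)" by (rule R(1))
  have "op_norm X (resolvent X l (generator X T)) / ereal (K \<bar>Im l\<bar>) \<le> ereal (D * K \<bar>Im l\<bar>) / ereal (K \<bar>Im l\<bar>)"
    using R(2) K by (intro ereal_divide_right_mono) auto
  then show "op_norm X (resolvent X l (generator X T)) / ereal (K \<bar>Im l\<bar>) \<le> ereal D"
    using K by simp
qed

text \<open>The exponent equals \<open>8 * t n / (\<delta> * M (u n))\<close>, the one in
  \<open>tame\<close>, and \<open>w n\<close> supplies the factor \<open>1 / K (u n)\<close> that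
  cancels its right-hand side. The \<open>10\<close> is \<open>5 * 2\<close>, from
  \<open>sqrt (3 * (t n / r n)) \<le> 2 * sqrt (t n / r n)\<close>.\<close>

lemma test_vector_bound: "1 + 5 * w n * sqrt (a n * t n) * exp (2 * (a n * t n) * (2 * (b n / a n))) \<le> 1 + 10 * C"
proof -
  have t: "0 < t n" using MK_ge[of n] by (simp add: t_def)
  have K: "0 < K (u n)" by (rule K_pos[OF u_nonneg])
  have "sqrt (a n * t n) / a n = sqrt (a n * t n / (a n)\<^sup>2)"
    using a_pos[of n] by (simp add: real_sqrt_divide)
  also have "\<dots> = sqrt (3 * (t n / r n))"
    using r_bounds[of n] by (simp add: a_def power2_eq_square field_simps)
  also have "\<dots> \<le> sqrt (4 * (t n / r n))"
    using t r_bounds[of n] by (intro real_sqrt_le_mono mult_right_mono) auto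
  also have "\<dots> = 2 * sqrt (t n / r n)" by (simp only: real_sqrt_mult) simp
  finally have 1: "sqrt (a n * t n) / a n \<le> 2 * sqrt (t n / r n)" .
  have 2: "exp (2 * (a n * t n) * (2 * (b n / a n))) = exp (8 * t n / (\<delta> * M (u n)))"
    using a_pos[of n] by (simp add: b_def)
  have "5 * w n * sqrt (a n * t n) * exp (2 * (a n * t n) * (2 * (b n / a n)))
      = 5 * (sqrt (a n * t n) / a n) * exp (8 * t n / (\<delta> * M (u n))) / K (u n)"
    unfolding 2 by (simp add: w_def)
  also have "\<dots> \<le> 5 * (2 * sqrt (t n / r n)) * exp (8 * t n / (\<delta> * M (u n))) / K (u n)"
    using K by (intro divide_right_mono mult_right_mono mult_left_mono 1) auto
  also have "\<dots> = 10 * (sqrt (t n / r n) * exp (8 * t n / (\<delta> * M (u n)))) / K (u n)" by simp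
  also have "\<dots> \<le> 10 * (C * K (u n)) / K (u n)"
    using tame[of n] K by (intro divide_right_mono mult_left_mono) (auto simp: tame_def t_def u_def)
  also have "\<dots> = 10 * C" using K by simp
  finally show ?thesis by simp
qed

text \<open>\<open>MK_inv\<close> returns \<open>s n\<close> at time \<open>t n\<close>, while
  \<open>A\<close> has norm at most \<open>2 * s n\<close> on the block; the frequency cancels and
  leaves a bound independent of \<open>n\<close>.\<close>

lemma decay_lower:
  "ereal (3 / 8 / (1 + 10 * C)) \<le> op_norm X (\<lambda>x.
     complex_of_real (MK_inv M K (t n)) \<odot>\<^bsub>X\<^esub> T (t n) (op_inverse (generator X T) x))"
proof -
  have s: "1 \<le> s n" using r_bounds[of n] by simp
  have "0 \<in> Omega (\<lambda>s. \<delta> * M s)" using M_pos[of 0] \<delta>_ge by (simp add: Omega_def)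
  note inv = resolvent_bound(1)[OF this]
  have at: "4 \<le> a n * t n"
    using mult_mono[of "1/3" "a n" 12 "t n"] a_ge[of n] MK_ge[of n] by (simp add: t_def)
  have "q n = 1 / (1 - b n / a n)" using a_pos[of n] b_bounds[of n] by (simp add: q_def field_simps)
  also have "\<dots> \<le> exp (2 * (b n / a n))"
    using a_pos[of n] b_bounds[of n] by (intro inverse_one_minus_le_exp) (auto simp: field_simps)
  finally have q: "q n \<le> exp (2 * (b n / a n))" .
  have dim: "2 * (a n * t n) < real (d n)" unfolding d_def by linarith
  have "cmod (z n) \<le> a n + s n"
    using cmod_le[of "z n"] a_pos[of n] s by (simp add: z_def)
  moreover have "2 * a n \<le> s n" using r_bounds[of n] by (simp add: a_def)
  ultimately have z: "cmod (z n) + a n \<le> 2 * s n" by simp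
  have "3 / 8 / B = s n * (3 / 4) / (2 * s n * B)" for B
    using s by simp
  then have "3 / 8 / (1 + 10 * C) = s n * (3 / 4) / (2 * s n * (1 + 10 * C))" .
  also have "\<dots> \<le> s n * (3 / 4) / ((cmod (z n) + a n) * (1 + 10 * C))"
    using s C_pos z a_pos[of n] by (intro divide_left_mono mult_right_mono mult_pos_pos add_nonneg_pos) auto
  also have "s n = cmod (complex_of_real (MK_inv M K (t n)))"
    using s by (simp add: t_def MK_inv_MK)
  finally have "ereal (3 / 8 / (1 + 10 * C)) \<le>
      ereal (cmod (complex_of_real (MK_inv M K (t n))) * (3 / 4) / ((cmod (z n) + a n) * (1 + 10 * C)))"
    by simp
  also have "\<dots> \<le> op_norm X (\<lambda>x.
     complex_of_real (MK_inv M K (t n)) \<odot>\<^bsub>X\<^esub> T (t n) (op_inverse (generator X T) x))"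
    using MK_ge[of n] by (intro op_norm_ge[OF inv _ at dim q test_vector_bound]) (simp add: t_def)
  finally show ?thesis .
qed

lemma t_at_top: "filterlim t at_top sequentially"
  unfolding t_def[abs_def]
  by (rule filterlim_compose[OF MK_at_top])
    (rule filterlim_at_top_mono[OF filterlim_real_sequentially], simp add: s_ge)

end

theorem theorem3p1:
  fixes M K :: "real \<Rightarrow> real"
  assumes "regularly_growing M"
    and "regularly_growing K"
    and "\<forall>s\<ge>0. K s \<ge> M s"
    and "\<exists>\<alpha>>0. MK M K \<in> O[at_top](\<lambda>s. exp (\<alpha> * s))"
  shows "\<exists>(X :: (real \<Rightarrow> complex) complex_normed) (T :: real \<Rightarrow> (real \<Rightarrow> complex) \<Rightarrow> (real \<Rightarrow> complex)).
    complex_banach X \<and> C0_semigroup X T \<and> bounded_semigroup X T \<and>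
    (\<exists>\<delta>>1.
      Omega (\<lambda>s. \<delta> * M s) \<subseteq> resolvent_set X (generator X T) \<and>
      (SUP l\<in>Omega (\<lambda>s. \<delta> * M s).
         op_norm X (resolvent X l (generator X T)) / ereal (K \<bar>Im l\<bar>)) < \<infinity>) \<and>
    Limsup at_top (\<lambda>t. op_norm X (\<lambda>x.
      complex_of_real (MK_inv M K t) \<odot>\<^bsub>X\<^esub> T t (op_inverse (generator X T) x))) > 0"
proof -
  interpret growth_pair M K by (rule growth_pairI) (fact assms)+
  from assms(4) obtain \<alpha> where "MK M K \<in> O[at_top](\<lambda>s. exp (\<alpha> * s))" "0 < \<alpha>" by blast
  from tame_exists[OF this] obtain C \<delta>0
    where C: "0 < C" "\<And>\<delta> S. \<delta> \<ge> \<delta>0 \<Longrightarrow> \<exists>s\<ge>S. \<exists>r. tame C \<delta> s r" by metis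
  \<comment> \<open>\<open>C\<close> is fixed independently of \<open>\<delta>\<close>, so
    \<open>\<delta>\<close> can be raised to meet the requirements of
    \<open>tame_sequence\<close>.\<close>
  define \<delta> where "\<delta> = max \<delta>0 (max 2 (12 / M 0))"
  have \<delta>: "\<delta>0 \<le> \<delta>" "2 \<le> \<delta>" "12 / M 0 \<le> \<delta>" by (auto simp: \<delta>_def)
  obtain S0 where S0: "\<And>s. S0 \<le> s \<Longrightarrow> 12 \<le> MK M K s"
    using MK_at_top by (auto simp: filterlim_at_top eventually_at_top_linorder)
  have "\<exists>s r. max (real n) S0 \<le> s \<and> tame C \<delta> s r" for n
    using C(2)[OF \<delta>(1)] by blast
  then obtain s r where sr: "\<And>n. max (real n) S0 \<le> s n" "\<And>n. tame C \<delta> (s n) (r n)"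
    by metis
  interpret tame_sequence M K C \<delta> s r
    by unfold_locales (use C(1) \<delta> sr S0 in auto)
  have "(SUP l\<in>Omega (\<lambda>s. \<delta> * M s). op_norm X (resolvent X l (generator X T)) / ereal (K \<bar>Im l\<bar>)) \<le> ereal D"
    by (rule SUP_least) (rule resolvent_bound)
  then have sup: "(SUP l\<in>Omega (\<lambda>s. \<delta> * M s). op_norm X (resolvent X l (generator X T)) / ereal (K \<bar>Im l\<bar>)) < \<infinity>"
    by (rule le_less_trans) simp
  have limsup: "Limsup at_top (\<lambda>t. op_norm X (\<lambda>x.
      complex_of_real (MK_inv M K t) \<odot>\<^bsub>X\<^esub> T t (op_inverse (generator X T) x))) > 0"
  proof (rule Limsup_pos_of_sequence[OF t_at_top])
    show "ereal (3 / 8 / (1 + 10 * C)) \<le> op_norm X (\<lambda>x.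
      complex_of_real (MK_inv M K (t n)) \<odot>\<^bsub>X\<^esub> T (t n) (op_inverse (generator X T) x))" for n
      by (rule decay_lower)
  qed (use C(1) in simp)
  have omega: "Omega (\<lambda>s. \<delta> * M s) \<subseteq> resolvent_set X (generator X T)"
    using resolvent_bound(1) by blast
  show ?thesis
  proof (rule exI[where x = X], rule exI[where x = T], intro conjI)
    show "\<exists>\<delta>>1. Omega (\<lambda>s. \<delta> * M s) \<subseteq> resolvent_set X (generator X T) \<and>
      (SUP l\<in>Omega (\<lambda>s. \<delta> * M s). op_norm X (resolvent X l (generator X T)) / ereal (K \<bar>Im l\<bar>)) < \<infinity>"
      by (rule exI[where x = \<delta>], intro conjI omega sup) (use \<delta>(2) in simp)
  qed (rule X_complete C0_semigroup_T bounded_semigroup_T limsup)+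
qed

end
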